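(* There is a unique family of specialization functors $\{F_x\}_{x\in\mathbb{Q}}$ on $\infty\mathbf{Web}$ such that, writing $\widetilde{\{x\}}:=F_x\left(\frac{a^2-1}{q^2-1}\right)\in\mathbb{Q}(q)$: (i) for all $n\in\mathbb{N}$, $F_n:\infty\mathbf{Web}\to n\mathbf{Web}$ is the usual specialization functor $a=q^n$; (ii) for all $x\in\mathbb{Q}$, $\widetilde{\{x+1\}}=q^2\,\widetilde{\{x\}}+1$; (iii) there is a relation of the form $\widetilde{\left\{\frac1x\right\}}=q^{\alpha}\,\frac{1}{\widetilde{\{x\}}_{q^{\epsilon}}}$ for some $\alpha\in\mathbb{Z}$ and $\epsilon\in\{\pm1\}$ not depending on $x$ (for all $x\in\mathbb{Q}\setminus\{0\}$), where the subscript $q^\epsilon$ means that $q$ is replaced by $q^{\epsilon}$. This unique family is the one given by the specializations $F_x:\infty\mathbf{Web}\to x\mathbf{Web}$, $a\mapsto q\nu_x\delta_x$.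
   Context: **$q$-rationals.** For $n\in\mathbb{Z}$, $\{n\}=\frac{q^{2n}-1}{q^2-1}$, and $\{n\}_-:=\frac{q^{-2n}-1}{q^{-2}-1}$. For $x\in\mathbb{Q}$ let $x=[a_1,\dots,a_n]$ be its continued fraction expansion $a_1+\cfrac{1}{a_2+\cdots}$ of even length $n$ ($a_1\in\mathbb{Z}$, $a_i\ge1$ for $i\ge2$). Then $$\{x\}=\{a_1\}+\cfrac{q^{2a_1}}{\{a_2\}_-+\cfrac{q^{-2a_2}}{\{a_3\}+\cfrac{q^{2a_3}}{\ddots+\cfrac{q^{2a_{n-1}}}{\{a_n\}_-}}}}\in\mathbb{Q}(q).$$ For integers $n,k\geq 0$, $\genfrac{\{}{\}}{0pt}{}{n}{k}=\frac{\{n\}\cdots\{n-k+1\}}{\{k\}\cdots\{1\}}$. Put $\delta_x=\{x\}-\{x-1\}$ and let $\nu_x$ be a square root: $\nu_x^2=\delta_x^{-1}$ (with $\nu_n=q^{1-n}$ for integral $x=n$). **Upward webs.** $\infty\mathbf{Web}^+$ is the $\mathbb{Z}[q^{\pm1}]$-linear strict monoidal category with objects finite sequences of positive integers (labelled upward arrows), and morphisms (read bottom to top) generated by merges $m_{k,l}:(k,l)\to(k+l)$ and splits $s_{k,l}:(k+l)\to(k,l)$. Edges labelled $0$ are erased; webs with a negative label are zero. On two adjacent strands (numbers $i,i+1$) labelled $(k,l)$ let $F_i^{(j)}=(\mathrm{id}_{k-j}\otimes m_{j,l})(s_{k-j,j}\otimes \mathrm{id}_l)$ and $E_i^{(j)}=(m_{k,j}\otimes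 \mathrm{id}_{l-j})(\mathrm{id}_k\otimes s_{j,l-j})$ (upper index $1$ omitted). Relations: associativity of merges and coassociativity of splits; $m_{k,l}s_{k,l}=q^{-kl}\genfrac{\{}{\}}{0pt}{}{k+l}{k}\mathrm{id}_{k+l}$; on strands $(k,l)$, $E_1F_1-F_1E_1=q^{1-k+l}\{k-l\}\,\mathrm{id}$; on three strands, $E_1^{(2)}E_2-E_1E_2E_1+E_2E_1^{(2)}=0$, $E_2^{(2)}E_1-E_2E_1E_2+E_1E_2^{(2)}=0$, and the same with $E$ replaced by $F$. The braiding $k\otimes l\to l\otimes k$ (strand from bottom left to top right over) is $(-q)^{kl}\sum_{a,b\ge0,\,b-a=k-l}(-q)^{b-k}E_1^{(a)}F_1^{(b)}$. **The category $\infty\mathbf{Web}$** is the braided pivotal category generated by $\infty\mathbf{Web}^+$ over $\mathbb{Z}[q^{\pm1},a^{\pm1}][(q-q^{-1})^{-1}]$ (adjoining downward arrows as duals, cups and caps, up to planar isotopy), with the additional relations: a $1$-labelled circle of either orientation equals $\frac{a-a^{-1}}{q-q^{-1}}$; the right and left partial traces over one strand of $s_{1,1}m_{1,1}$ both equal $\frac{aq^{-1}-a^{-1}q}{q-q^{-1}}\mathrm{id}_1$; and $Sq=\mathrm{id}_{\uparrow\downarrow}+\frac{aq^{-2}-a^{-1}q^2}{q-q^{-1}}(\text{cup}\circ\text{cap})$ together with its mirror image, where $Sq$ is the endomorphism of (upward $1$, downward $1$) shaped as a square with horizontal edges labelled $2$ (bottom oriented left to right, top right to left), vertical edges labelled $1$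 (left downward, right upward) and four outer legs labelled $1$ at the corners (entering at bottom left and top right, exiting at bottom right and top left). **Specializations.** A specialization functor $F_x$ is the functor from $\infty\mathbf{Web}$ obtained by specializing the variable $a$ in the coefficient ring while keeping $q$ (base change along a ring homomorphism fixing $q$ to $\mathbb{Q}(q)$ or a quadratic extension of it, with $a^2$ sent into $\mathbb{Q}(q)$); it is determined by the image of $a$. The choice of one of the two square roots of the image of $a^2$ is not regarded as part of the data (it corresponds to the choice of $\nu_x$). The image under $F_x$ of a scalar means its image in the specialized ring; $\frac{a^2-1}{q^2-1}$ is the value in $\infty\mathbf{Web}$ of the unknot diagram with one negative curl (the "stabilized unknot"). $n\mathbf{Web}$ is the specialization of $\infty\mathbf{Web}$ at $a=q^n$, and $x\mathbf{Web}$ is the $\mathbb{Z}(q)[\nu_x]$-linear specialization of $\infty\mathbf{Web}$ at $a=q\nu_x\delta_x$, where $\mathbb{Z}(q)$ is the field of rational fractions in $q$. *)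

theory Defs
  imports "HOL-Algebra.Algebraic_Closure_Type" "HOL-Algebra.Generated_Rings"
begin

section \<open>Quantum integers and \<open>q\<close>-rationals\<close>

text \<open>\<open>qint q n\<close> is \<open>{n}\<close>; the variant \<open>{n}\<^sub>-\<close> is \<open>qint (inverse q) n\<close>.\<close>

definition qint :: "'k::field \<Rightarrow> int \<Rightarrow> 'k" where
  "qint q n = (q powi (2 * n) - 1) / (q\<^sup>2 - 1)"

definition qbinom :: "'k::field \<Rightarrow> nat \<Rightarrow> nat \<Rightarrow> 'k" where
  "qbinom q n k = (\<Prod>i<k. qint q (int n - int i)) / (\<Prod>i<k. qint q (int (k - i)))"

fun cfrac_value :: "int list \<Rightarrow> rat" where
  "cfrac_value [] = 0"
| "cfrac_value [a] = of_int a"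
| "cfrac_value (a # b # as) = of_int a + 1 / cfrac_value (b # as)"

text \<open>Each step down the fraction replaces \<open>q\<close> by its inverse, which produces the alternation
  between \<open>{a\<^sub>i}\<close>, \<open>q\<^bsup>2a\<^sub>i\<^esup>\<close> and \<open>{a\<^sub>i}\<^sub>-\<close>, \<open>q\<^bsup>-2a\<^sub>i\<^esup>\<close>.\<close>

fun qcfrac :: "'k::field \<Rightarrow> int list \<Rightarrow> 'k" where
  "qcfrac q [] = 0"
| "qcfrac q [a] = qint q a"
| "qcfrac q (a # b # as) = qint q a + q powi (2 * a) / qcfrac (inverse q) (b # as)"

definition even_cfrac_expansion :: "rat \<Rightarrow> int list \<Rightarrow> bool" where
  "even_cfrac_expansion x as \<longleftrightarrow>
     as \<noteq> [] \<and> even (length as) \<and> (\<forall>a \<in> set (tl as). a \<ge> 1) \<and> cfrac_value as = x"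

text \<open>The fraction field of \<open>\<int>[q]\<close> is the field of rational fractions in \<open>q\<close>.\<close>

type_synonym Qq = "int poly fract"

definition qvar :: Qq where
  "qvar = to_fract [:0, 1:]"

definition qrat :: "rat \<Rightarrow> Qq" where
  "qrat x = qcfrac qvar (THE as. even_cfrac_expansion x as)"

definition qdelta :: "rat \<Rightarrow> Qq" where
  "qdelta x = qrat x - qrat (x - 1)"

text \<open>\<open>qsubst \<epsilon> f\<close> is \<open>f\<close> with \<open>q\<close> replaced by \<open>q\<^sup>\<epsilon>\<close>.\<close>

definition qsubst :: "int \<Rightarrow> Qq \<Rightarrow> Qq" where
  "qsubst e f = (let (num, den) = quot_of_fract f in
     poly (map_poly of_int num) (qvar powi e) / poly (map_poly of_int den) (qvar powi e))"


section \<open>Webs\<close>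

text \<open>Objects are finite sequences of oriented strands with positive labels; they are the same
  for all the categories below. Morphisms are linear combinations of webs, given as formal
  expressions in the generators modulo the relations.\<close>

datatype orientation = Up | Down

type_synonym strand = "orientation \<times> nat"
type_synonym obj = "strand list"

definition valid_obj :: "obj \<Rightarrow> bool" where
  "valid_obj A \<longleftrightarrow> (\<forall>s \<in> set A. snd s > 0)"

fun flip :: "strand \<Rightarrow> strand" where
  "flip (Up, k) = (Down, k)"
| "flip (Down, k) = (Up, k)"

definition dual :: "obj \<Rightarrow> obj" where
  "dual A = rev (map flip A)"

text \<open>\<open>Comp f g\<close> is \<open>f\<close> on top of \<open>g\<close>. \<open>Cup s\<close> goes from the empty object to \<open>[s, flip s]\<close> and
  \<open>Cap s\<close> from \<open>[s, flip s]\<close> to the empty object, so that both orientations of cups and caps occur.\<close>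

datatype 'k web =
    Ident obj
  | Merge nat nat
  | Split nat nat
  | Cup strand
  | Cap strand
  | Braid obj obj
  | BraidInv obj obj
  | Comp "'k web" "'k web"
  | Tens "'k web" "'k web"
  | Zero obj obj
  | Plus "'k web" "'k web"
  | Scale 'k "'k web"

inductive typed :: "'k set \<Rightarrow> 'k web \<Rightarrow> obj \<Rightarrow> obj \<Rightarrow> bool" for S where
  "valid_obj A \<Longrightarrow> typed S (Ident A) A A"
| "k > 0 \<Longrightarrow> l > 0 \<Longrightarrow> typed S (Merge k l) [(Up, k), (Up, l)] [(Up, k + l)]"
| "k > 0 \<Longrightarrow> l > 0 \<Longrightarrow> typed S (Split k l) [(Up, k + l)] [(Up, k), (Up, l)]"
| "valid_obj [s] \<Longrightarrow> typed S (Cup s) [] [s, flip s]"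
| "valid_obj [s] \<Longrightarrow> typed S (Cap s) [s, flip s] []"
| "valid_obj A \<Longrightarrow> valid_obj B \<Longrightarrow> typed S (Braid A B) (A @ B) (B @ A)"
| "valid_obj A \<Longrightarrow> valid_obj B \<Longrightarrow> typed S (BraidInv A B) (B @ A) (A @ B)"
| "typed S f B C \<Longrightarrow> typed S g A B \<Longrightarrow> typed S (Comp f g) A C"
| "typed S f A B \<Longrightarrow> typed S g C D \<Longrightarrow> typed S (Tens f g) (A @ C) (B @ D)"
| "valid_obj A \<Longrightarrow> valid_obj B \<Longrightarrow> typed S (Zero A B) A B"
| "typed S f A B \<Longrightarrow> typed S g A B \<Longrightarrow> typed S (Plus f g) A B"
| "c \<in> S \<Longrightarrow> typed S f A B \<Longrightarrow> typed S (Scale c f) A B"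

subsection \<open>Ladders\<close>

text \<open>Ladders have integer uprights: uprights labelled \<open>0\<close> are erased, and a rung producing a
  negative label is the zero web.\<close>

definition up_strand :: "int \<Rightarrow> obj" where
  "up_strand k = (if k \<le> 0 then [] else [(Up, nat k)])"

definition up_strands :: "int list \<Rightarrow> obj" where
  "up_strands ks = concat (map up_strand ks)"

definition ladder_merge :: "int \<Rightarrow> int \<Rightarrow> 'k web" where
  "ladder_merge k l = (if k \<le> 0 \<or> l \<le> 0 then Ident (up_strand k @ up_strand l) else Merge (nat k) (nat l))"

definition ladder_split :: "int \<Rightarrow> int \<Rightarrow> 'k web" where
  "ladder_split k l = (if k \<le> 0 \<or> l \<le> 0 then Ident (up_strand k @ up_strand l) else Split (nat k) (nat l))"

definition rungF :: "int \<Rightarrow> int \<Rightarrow> int \<Rightarrow> 'k web" where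
  "rungF j k l = (if j \<ge> 0 \<and> l \<ge> 0 \<and> k - j \<ge> 0
     then Comp (Tens (Ident (up_strand (k - j))) (ladder_merge j l)) (Tens (ladder_split (k - j) j) (Ident (up_strand l)))
     else Zero (up_strand k @ up_strand l) (up_strand (k - j) @ up_strand (l + j)))"

definition rungE :: "int \<Rightarrow> int \<Rightarrow> int \<Rightarrow> 'k web" where
  "rungE j k l = (if j \<ge> 0 \<and> k \<ge> 0 \<and> l - j \<ge> 0
     then Comp (Tens (ladder_merge k j) (Ident (up_strand (l - j)))) (Tens (Ident (up_strand k)) (ladder_split j (l - j)))
     else Zero (up_strand k @ up_strand l) (up_strand (k + j) @ up_strand (l - j)))"

text \<open>\<open>E i j\<close> and \<open>F i j\<close> stand for the \<open>j\<close>-th divided powers on strands \<open>i, i + 1\<close>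
  (numbered from 1).\<close>

datatype rung = E nat int | F nat int

fun rung_labels :: "rung \<Rightarrow> int list \<Rightarrow> int list" where
  "rung_labels (E i j) ks = ks[i - 1 := ks ! (i - 1) + j, i := ks ! i - j]"
| "rung_labels (F i j) ks = ks[i - 1 := ks ! (i - 1) - j, i := ks ! i + j]"

fun rung_web :: "rung \<Rightarrow> int list \<Rightarrow> 'k web" where
  "rung_web (E i j) ks = Tens (Ident (up_strands (take (i - 1) ks)))
     (Tens (rungE j (ks ! (i - 1)) (ks ! i)) (Ident (up_strands (drop (i + 1) ks))))"
| "rung_web (F i j) ks = Tens (Ident (up_strands (take (i - 1) ks)))
     (Tens (rungF j (ks ! (i - 1)) (ks ! i)) (Ident (up_strands (drop (i + 1) ks))))"

text \<open>The product of the rungs \<open>rs\<close> applied to bottom labels \<open>ks\<close>; the last rung acts first.\<close>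

fun ladder :: "rung list \<Rightarrow> int list \<Rightarrow> 'k web" where
  "ladder [] ks = Ident (up_strands ks)"
| "ladder (r # rs) ks = Comp (rung_web r (foldr rung_labels rs ks)) (ladder rs ks)"

definition minus_web :: "'k::field web \<Rightarrow> 'k web \<Rightarrow> 'k web" where
  "minus_web f g = Plus f (Scale (- 1) g)"

text \<open>Only finitely many terms of the sum are nonzero: \<open>b > k\<close> would give a negative label, and
  \<open>a = b - k + l\<close> must be nonnegative.\<close>

definition crossing :: "'k::field \<Rightarrow> nat \<Rightarrow> nat \<Rightarrow> 'k web" where
  "crossing q k l = Scale ((- q) ^ (k * l))
     (foldr Plus
       (map (\<lambda>b. Scale ((- q) powi (b - int k)) (ladder [E 1 (b - int k + int l), F 1 b] [int k, int l]))
          [max 0 (int k - int l)..int k])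
       (Zero [(Up, k), (Up, l)] [(Up, l), (Up, k)]))"

subsection \<open>Duality and closed-up webs\<close>

fun cups :: "obj \<Rightarrow> 'k web" where
  "cups [] = Ident []"
| "cups (s # A) = Comp (Tens (Ident [s]) (Tens (cups A) (Ident [flip s]))) (Cup s)"

fun caps :: "obj \<Rightarrow> 'k web" where
  "caps [] = Ident []"
| "caps (s # A) = Comp (Cap s) (Tens (Ident [s]) (Tens (caps A) (Ident [flip s])))"

text \<open>Both transposes of a web from \<open>A\<close> to \<open>B\<close>, i.e. its two rotations by a half turn, go from
  \<open>dual B\<close> to \<open>dual A\<close>. Note \<open>dual (dual A) = A\<close>, so \<open>cups A\<close> and \<open>cups (dual A)\<close> are
  the two coevaluations, and likewise for \<open>caps\<close>.\<close>

definition left_transpose :: "obj \<Rightarrow> obj \<Rightarrow> 'k web \<Rightarrow> 'k web" where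
  "left_transpose A B f =
     Comp (Tens (caps (dual B)) (Ident (dual A)))
       (Comp (Tens (Ident (dual B)) (Tens f (Ident (dual A))))
         (Tens (Ident (dual B)) (cups A)))"

definition right_transpose :: "obj \<Rightarrow> obj \<Rightarrow> 'k web \<Rightarrow> 'k web" where
  "right_transpose A B f =
     Comp (Tens (Ident (dual A)) (caps B))
       (Comp (Tens (Ident (dual A)) (Tens f (Ident (dual B))))
         (Tens (cups (dual A)) (Ident (dual B))))"

abbreviation u1 :: strand where "u1 \<equiv> (Up, 1)"
abbreviation d1 :: strand where "d1 \<equiv> (Down, 1)"

definition split_merge :: "'k web" where
  "split_merge = Comp (Split 1 1) (Merge 1 1)"

definition right_trace :: "'k web \<Rightarrow> 'k web" where
  "right_trace f = Comp (Tens (Ident [u1]) (Cap u1))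
     (Comp (Tens f (Ident [d1])) (Tens (Ident [u1]) (Cup u1)))"

definition left_trace :: "'k web \<Rightarrow> 'k web" where
  "left_trace f = Comp (Tens (Cap d1) (Ident [u1]))
     (Comp (Tens (Ident [d1]) f) (Tens (Cup d1) (Ident [u1])))"

text \<open>The halves of the square \<open>Sq\<close>, cut horizontally through its vertical edges; each is
  a rotated \<open>split_merge\<close> whose \<open>2\<close>-labelled edge is a horizontal edge of the square. In
  \<open>square_bottom\<close>, from \<open>[u1, d1]\<close> to \<open>[d1, u1]\<close>, the left vertical edge comes down and merges
  with the bottom left leg, and the \<open>2\<close>-labelled edge splits into the right vertical edge and
  the bottom right leg. Reflection in a vertical axis exchanges the two halves.\<close>

definition square_bottom :: "'k web" where
  "square_bottom = Comp (Tens (Ident [d1, u1]) (Cap u1))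
     (Comp (Tens (Ident [d1]) (Tens split_merge (Ident [d1])))
       (Tens (Cup d1) (Ident [u1, d1])))"

definition square_top :: "'k web" where
  "square_top = Comp (Tens (Cap d1) (Ident [u1, d1]))
     (Comp (Tens (Ident [d1]) (Tens split_merge (Ident [d1])))
       (Tens (Ident [d1, u1]) (Cup u1)))"

definition Sq :: "'k web" where
  "Sq = Comp square_top square_bottom"

definition Sq_mirror :: "'k web" where
  "Sq_mirror = Comp square_bottom square_top"

subsection \<open>Relations\<close>

text \<open>The defining relations of the category of upward webs.\<close>

inductive upward_rel :: "'k::field \<Rightarrow> 'k web \<Rightarrow> 'k web \<Rightarrow> bool" for q where
  merge_assoc: "upward_rel q
    (Comp (Merge (k + l) m) (Tens (Merge k l) (Ident [(Up, m)])))
    (Comp (Merge k (l + m)) (Tens (Ident [(Up, k)]) (Merge l m)))"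
| split_coassoc: "upward_rel q
    (Comp (Tens (Split k l) (Ident [(Up, m)])) (Split (k + l) m))
    (Comp (Tens (Ident [(Up, k)]) (Split l m)) (Split k (l + m)))"
| digon: "upward_rel q
    (Comp (Merge k l) (Split k l))
    (Scale (q powi (- int (k * l)) * qbinom q (k + l) k) (Ident [(Up, k + l)]))"
| EF_commutator: "k \<ge> 0 \<Longrightarrow> l \<ge> 0 \<Longrightarrow> upward_rel q
    (minus_web (ladder [E 1 1, F 1 1] [k, l]) (ladder [F 1 1, E 1 1] [k, l]))
    (Scale (q powi (1 - k + l) * qint q (k - l)) (Ident (up_strands [k, l])))"
| serre: "P = E \<or> P = F \<Longrightarrow> i = 1 \<and> i' = 2 \<or> i = 2 \<and> i' = 1 \<Longrightarrow>
    k \<ge> 0 \<Longrightarrow> l \<ge> 0 \<Longrightarrow> m \<ge> 0 \<Longrightarrow> upward_rel q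
    (Plus (minus_web (ladder [P i 2, P i' 1] [k, l, m]) (ladder [P i 1, P i' 1, P i 1] [k, l, m]))
       (ladder [P i' 1, P i 2] [k, l, m]))
    (Zero A B)"

text \<open>All relations: the axioms of a strict braided pivotal linear category, those of
  upward webs, the value of the braiding on upward strands, and the relations involving \<open>a\<close>.
  They are imposed between webs of the same type with coefficients in the ring \<open>S\<close>, see
  \<open>web_eq\<close>.\<close>

inductive web_rel :: "'k::field set \<Rightarrow> 'k \<Rightarrow> 'k \<Rightarrow> 'k web \<Rightarrow> 'k web \<Rightarrow> bool" for S q a where
  comp_ident_left: "web_rel S q a (Comp (Ident B) f) f"
| comp_ident_right: "web_rel S q a (Comp f (Ident A)) f"
| comp_assoc: "web_rel S q a (Comp (Comp f g) h) (Comp f (Comp g h))"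
| tens_unit_left: "web_rel S q a (Tens (Ident []) f) f"
| tens_unit_right: "web_rel S q a (Tens f (Ident [])) f"
| tens_assoc: "web_rel S q a (Tens (Tens f g) h) (Tens f (Tens g h))"
| tens_ident: "web_rel S q a (Tens (Ident A) (Ident B)) (Ident (A @ B))"
| interchange: "web_rel S q a (Comp (Tens f g) (Tens f' g')) (Tens (Comp f f') (Comp g g'))"
| plus_assoc: "web_rel S q a (Plus (Plus f g) h) (Plus f (Plus g h))"
| plus_commute: "web_rel S q a (Plus f g) (Plus g f)"
| plus_zero: "web_rel S q a (Plus (Zero A B) f) f"
| scale_zero: "web_rel S q a (Scale 0 f) (Zero A B)"
| scale_one: "web_rel S q a (Scale 1 f) f"
| scale_scale: "web_rel S q a (Scale c (Scale d f)) (Scale (c * d) f)"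
| scale_plus_scalars: "web_rel S q a (Scale (c + d) f) (Plus (Scale c f) (Scale d f))"
| scale_plus: "web_rel S q a (Scale c (Plus f g)) (Plus (Scale c f) (Scale c g))"
| comp_plus_left: "web_rel S q a (Comp (Plus f g) h) (Plus (Comp f h) (Comp g h))"
| comp_plus_right: "web_rel S q a (Comp h (Plus f g)) (Plus (Comp h f) (Comp h g))"
| comp_scale_left: "web_rel S q a (Comp (Scale c f) g) (Scale c (Comp f g))"
| comp_scale_right: "web_rel S q a (Comp f (Scale c g)) (Scale c (Comp f g))"
| tens_plus_left: "web_rel S q a (Tens (Plus f g) h) (Plus (Tens f h) (Tens g h))"
| tens_plus_right: "web_rel S q a (Tens h (Plus f g)) (Plus (Tens h f) (Tens h g))"
| tens_scale_left: "web_rel S q a (Tens (Scale c f) g) (Scale c (Tens f g))"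
| tens_scale_right: "web_rel S q a (Tens f (Scale c g)) (Scale c (Tens f g))"
| zigzag_left: "web_rel S q a
    (Comp (Tens (Ident [s]) (Cap (flip s))) (Tens (Cup s) (Ident [s]))) (Ident [s])"
| zigzag_right: "web_rel S q a
    (Comp (Tens (Cap s) (Ident [s])) (Tens (Ident [s]) (Cup (flip s)))) (Ident [s])"
| pivotal: "typed S f A B \<Longrightarrow> web_rel S q a (left_transpose A B f) (right_transpose A B f)"
| braid_inverse_left: "web_rel S q a (Comp (BraidInv A B) (Braid A B)) (Ident (A @ B))"
| braid_inverse_right: "web_rel S q a (Comp (Braid A B) (BraidInv A B)) (Ident (B @ A))"
| braid_natural: "typed S f A A' \<Longrightarrow> typed S g B B' \<Longrightarrow>
    web_rel S q a (Comp (Braid A' B') (Tens f g)) (Comp (Tens g f) (Braid A B))"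
| hexagon_left: "web_rel S q a (Braid (A @ A') B)
    (Comp (Tens (Braid A B) (Ident A')) (Tens (Ident A) (Braid A' B)))"
| hexagon_right: "web_rel S q a (Braid A (B @ B'))
    (Comp (Tens (Ident B) (Braid A B')) (Tens (Braid A B) (Ident B')))"
| braid_upward: "k > 0 \<Longrightarrow> l > 0 \<Longrightarrow> web_rel S q a (Braid [(Up, k)] [(Up, l)]) (crossing q k l)"
| upward: "upward_rel q f g \<Longrightarrow> web_rel S q a f g"
| circle: "s = u1 \<or> s = d1 \<Longrightarrow> web_rel S q a
    (Comp (Cap s) (Cup s)) (Scale ((a - inverse a) / (q - inverse q)) (Ident []))"
| right_partial_trace: "web_rel S q a (right_trace split_merge)
    (Scale ((a * inverse q - inverse a * q) / (q - inverse q)) (Ident [u1]))"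
| left_partial_trace: "web_rel S q a (left_trace split_merge)
    (Scale ((a * inverse q - inverse a * q) / (q - inverse q)) (Ident [u1]))"
| square: "web_rel S q a Sq
    (Plus (Ident [u1, d1])
      (Scale ((a * q powi (-2) - inverse a * q\<^sup>2) / (q - inverse q)) (Comp (Cup u1) (Cap u1))))"
| square_mirror: "web_rel S q a Sq_mirror
    (Plus (Ident [d1, u1])
      (Scale ((a * q powi (-2) - inverse a * q\<^sup>2) / (q - inverse q)) (Comp (Cup d1) (Cap d1))))"

text \<open>Equality of webs; it relates only typed webs, and only webs of the same type.\<close>

inductive web_eq :: "'k::field set \<Rightarrow> 'k \<Rightarrow> 'k \<Rightarrow> 'k web \<Rightarrow> 'k web \<Rightarrow> bool" for S q a where
  rel: "web_rel S q a f g \<Longrightarrow> typed S f A B \<Longrightarrow> typed S g A B \<Longrightarrow> web_eq S q a f g"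
| refl: "typed S f A B \<Longrightarrow> web_eq S q a f f"
| sym: "web_eq S q a f g \<Longrightarrow> web_eq S q a g f"
| trans: "web_eq S q a f g \<Longrightarrow> web_eq S q a g h \<Longrightarrow> web_eq S q a f h"
| comp: "typed S (Comp f g) A B \<Longrightarrow> web_eq S q a f f' \<Longrightarrow> web_eq S q a g g' \<Longrightarrow>
    web_eq S q a (Comp f g) (Comp f' g')"
| tens: "typed S (Tens f g) A B \<Longrightarrow> web_eq S q a f f' \<Longrightarrow> web_eq S q a g g' \<Longrightarrow>
    web_eq S q a (Tens f g) (Tens f' g')"
| plus: "typed S (Plus f g) A B \<Longrightarrow> web_eq S q a f f' \<Longrightarrow> web_eq S q a g g' \<Longrightarrow>
    web_eq S q a (Plus f g) (Plus f' g')"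
| scale: "c \<in> S \<Longrightarrow> web_eq S q a f f' \<Longrightarrow> web_eq S q a (Scale c f) (Scale c f')"

subsection \<open>The category of webs over a coefficient ring\<close>

definition web_class :: "'k::field set \<Rightarrow> 'k \<Rightarrow> 'k \<Rightarrow> 'k web \<Rightarrow> 'k web set" where
  "web_class S q a f = {g. web_eq S q a f g}"

record 'k web_category =
  scalars :: "'k set"
  qpar :: 'k
  apar :: 'k
  homs :: "obj \<Rightarrow> obj \<Rightarrow> 'k web set set"
  ident :: "obj \<Rightarrow> 'k web set"
  compose :: "'k web set \<Rightarrow> 'k web set \<Rightarrow> 'k web set"
  tensor :: "'k web set \<Rightarrow> 'k web set \<Rightarrow> 'k web set"
  plus_hom :: "'k web set \<Rightarrow> 'k web set \<Rightarrow> 'k web set"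
  scale_hom :: "'k \<Rightarrow> 'k web set \<Rightarrow> 'k web set"

definition web_category :: "'k::field set \<Rightarrow> 'k \<Rightarrow> 'k \<Rightarrow> 'k web_category" where
  "web_category S q a =
    \<lparr> scalars = S, qpar = q, apar = a,
      homs = (\<lambda>A B. {web_class S q a f | f. typed S f A B}),
      ident = (\<lambda>A. web_class S q a (Ident A)),
      compose = (\<lambda>U V. \<Union>f\<in>U. \<Union>g\<in>V. web_class S q a (Comp f g)),
      tensor = (\<lambda>U V. \<Union>f\<in>U. \<Union>g\<in>V. web_class S q a (Tens f g)),
      plus_hom = (\<lambda>U V. \<Union>f\<in>U. \<Union>g\<in>V. web_class S q a (Plus f g)),
      scale_hom = (\<lambda>c U. \<Union>f\<in>U. web_class S q a (Scale c f)) \<rparr>"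

text \<open>\<open>semilinear_functor C D \<phi> T\<close>: \<open>T\<close> is a strict monoidal functor from \<open>C\<close> to \<open>D\<close>, the
  identity on objects, and linear along \<open>\<phi>\<close> on morphisms.\<close>

definition semilinear_functor ::
    "'k web_category \<Rightarrow> 'l web_category \<Rightarrow> ('k \<Rightarrow> 'l) \<Rightarrow> ('k web set \<Rightarrow> 'l web set) \<Rightarrow> bool" where
  "semilinear_functor C D \<phi> T \<longleftrightarrow>
     (\<forall>A B. \<forall>U \<in> homs C A B. T U \<in> homs D A B) \<and>
     (\<forall>A. valid_obj A \<longrightarrow> T (ident C A) = ident D A) \<and>
     (\<forall>A B B'. \<forall>U \<in> homs C B B'. \<forall>V \<in> homs C A B. T (compose C U V) = compose D (T U) (T V)) \<and>
     (\<forall>A A' B B'. \<forall>U \<in> homs C A A'. \<forall>V \<in> homs C B B'.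
        T (tensor C U V) = tensor D (T U) (T V)) \<and>
     (\<forall>A B. \<forall>U \<in> homs C A B. \<forall>V \<in> homs C A B. T (plus_hom C U V) = plus_hom D (T U) (T V)) \<and>
     (\<forall>A B. \<forall>c \<in> scalars C. \<forall>U \<in> homs C A B. T (scale_hom C c U) = scale_hom D (\<phi> c) (T U))"


section \<open>Specializations\<close>

text \<open>The coefficient ring \<open>\<int>[q\<^sup>\<plusminus>, a\<^sup>\<plusminus>][(q - q\<^bsup>-1\<^esup>)\<^bsup>-1\<^esup>]\<close> is a subring of the field of rational
  fractions in \<open>a\<close> over \<open>Qq\<close>.\<close>

type_synonym Qqa = "Qq poly fract"

definition q_inf :: Qqa where "q_inf = to_fract [:qvar:]"
definition a_inf :: Qqa where "a_inf = to_fract [:0, 1:]"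

definition coeff_ring :: "Qqa set" where
  "coeff_ring = generate_ring ring_of_type_algebra
     {q_inf, inverse q_inf, a_inf, inverse a_inf, inverse (q_inf - inverse q_inf)}"

definition infWeb :: "Qqa web_category" where
  "infWeb = web_category coeff_ring q_inf a_inf"

text \<open>All quadratic extensions of \<open>Qq\<close> are taken inside one algebraic closure.\<close>

type_synonym Qqbar = "Qq alg_closure"

definition q_ac :: Qqbar where "q_ac = to_ac qvar"

text \<open>For \<open>s\<^sup>2 \<in> range to_ac\<close> this is the field generated by \<open>s\<close> over \<open>Qq\<close>.\<close>

definition adjoin_root :: "Qqbar \<Rightarrow> Qqbar set" where
  "adjoin_root s = {to_ac u + to_ac v * s | u v. True}"

text \<open>A specialization functor consists of its target, its action on scalars and its action on
  morphisms, the latter two being \<open>undefined\<close> off the coefficient ring and off the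
  morphisms of \<open>infWeb\<close>. The target is the base change of \<open>infWeb\<close>, presented by the same webs
  and relations over the new coefficients, and the functor applies the ring homomorphism to the
  coefficients of a web.\<close>

record spec_functor =
  target :: "Qqbar web_category"
  on_scalars :: "Qqa \<Rightarrow> Qqbar"
  on_morphisms :: "Qqa web set \<Rightarrow> Qqbar web set"

definition specialization_functor :: "spec_functor \<Rightarrow> bool" where
  "specialization_functor T \<longleftrightarrow>
     on_scalars T \<in> ring_hom (ring_of_type_algebra\<lparr>carrier := coeff_ring\<rparr>)
       (ring_of_type_algebra\<lparr>carrier := adjoin_root (on_scalars T a_inf)\<rparr>) \<and>
     on_scalars T \<in> extensional coeff_ring \<and>
     on_scalars T q_inf = q_ac \<and>
     (on_scalars T a_inf)\<^sup>2 \<in> range to_ac \<and>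
     target T = web_category (adjoin_root (on_scalars T a_inf)) q_ac (on_scalars T a_inf) \<and>
     semilinear_functor infWeb (target T) (on_scalars T) (on_morphisms T) \<and>
     on_morphisms T \<in> extensional (\<Union>A B. homs infWeb A B) \<and>
     (\<forall>f A B. typed coeff_ring f A B \<longrightarrow>
        on_morphisms T (web_class coeff_ring q_inf a_inf f) =
          web_class (scalars (target T)) (qpar (target T)) (apar (target T))
            (map_web (on_scalars T) f))"

text \<open>\<open>T\<close> is the specialization functor from \<open>infWeb\<close> to \<open>D\<close> at \<open>a = s\<close>.\<close>

definition is_specialization :: "spec_functor \<Rightarrow> Qqbar web_category \<Rightarrow> Qqbar \<Rightarrow> bool" where
  "is_specialization T D s \<longleftrightarrow> specialization_functor T \<and> target T = D \<and> on_scalars T a_inf = s"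

text \<open>The choice of the square root of the image of \<open>a\<^sup>2\<close> is forgotten by passing to the class
  consisting of a specialization functor and the one with the opposite root.\<close>

definition root_class :: "spec_functor \<Rightarrow> spec_functor set" where
  "root_class T = {T'. specialization_functor T' \<and>
     (on_scalars T' a_inf = on_scalars T a_inf \<or> on_scalars T' a_inf = - on_scalars T a_inf)}"

definition nWeb :: "nat \<Rightarrow> Qqbar web_category" where
  "nWeb n = web_category (range to_ac) q_ac (q_ac ^ n)"

definition root_choice :: "(rat \<Rightarrow> Qqbar) \<Rightarrow> bool" where
  "root_choice \<nu> \<longleftrightarrow> (\<forall>x. (\<nu> x)\<^sup>2 = to_ac (inverse (qdelta x))) \<and>
     (\<forall>n::int. \<nu> (of_int n) = q_ac powi (1 - n))"

definition a_value :: "(rat \<Rightarrow> Qqbar) \<Rightarrow> rat \<Rightarrow> Qqbar" where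
  "a_value \<nu> x = q_ac * \<nu> x * to_ac (qdelta x)"

definition xWeb :: "(rat \<Rightarrow> Qqbar) \<Rightarrow> rat \<Rightarrow> Qqbar web_category" where
  "xWeb \<nu> x = web_category (adjoin_root (\<nu> x)) q_ac (a_value \<nu> x)"

text \<open>The value of the stabilized unknot under a specialization, as an element of \<open>Qq\<close>; it
  only involves \<open>a\<^sup>2\<close> and so does not depend on the choice of root.\<close>

definition stab_unknot :: Qqa where
  "stab_unknot = (a_inf\<^sup>2 - 1) / (q_inf\<^sup>2 - 1)"

definition stab_value :: "spec_functor set \<Rightarrow> Qq" where
  "stab_value \<T> = (THE v. \<forall>T \<in> \<T>. on_scalars T stab_unknot = to_ac v)"

definition canonical_family :: "(rat \<Rightarrow> spec_functor set) \<Rightarrow> bool" where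
  "canonical_family \<F> \<longleftrightarrow>
     (\<forall>x. \<exists>T. specialization_functor T \<and> \<F> x = root_class T) \<and>
     (\<forall>n::nat. \<exists>T. is_specialization T (nWeb n) (q_ac ^ n) \<and> \<F> (of_nat n) = root_class T) \<and>
     (\<forall>x. stab_value (\<F> (x + 1)) = qvar\<^sup>2 * stab_value (\<F> x) + 1) \<and>
     (\<exists>\<alpha>::int. \<exists>\<epsilon>\<in>{1, -1}. \<forall>x. x \<noteq> 0 \<longrightarrow>
        stab_value (\<F> x) \<noteq> 0 \<and>
        stab_value (\<F> (1 / x)) = qvar powi \<alpha> * (1 / qsubst \<epsilon> (stab_value (\<F> x))))"

end

theory Submission
  imports Defs
begin

text \<open>A specialization is determined up to the choice of root by the image of \<open>a\<^sup>2\<close>, hence by its value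
  \<open>v(x)\<close> on the stabilized unknot, and every nonzero square root of an element of the base field
  occurs, because the relations between webs survive evaluation at \<open>a = s\<close>. The values at \<open>1\<close> and
  \<open>-1\<close> force \<open>\<alpha> = 0\<close> and \<open>\<epsilon> = -1\<close>, and then \<open>x \<mapsto> x + 1\<close> and \<open>x \<mapsto> 1/x\<close> generate all values of \<open>v\<close>
  along a continued fraction, which yields \<open>v(x) = {x}\<close> and \<open>a\<^sup>2 = q\<^sup>2 \<delta>\<^sub>x\<close>. Conversely \<open>{x}\<close> satisfies
  the functional equations: for positive \<open>x\<close> they are read off the continued fraction, and negative
  \<open>x\<close> are reached through \<open>{-x} = -q\<^sup>-\<^sup>2 {x}\<close> with \<open>q\<close> replaced by \<open>q\<^sup>-\<^sup>1\<close> on the right.\<close>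

section \<open>Evaluation of rational fractions\<close>

text \<open>The points 1 and -1 decide the exponents because they are the rational fixed points of
  inversion: the value 1 at \<open>1\<close> is unchanged by any substitution, and the value
  \<open>-q^(-2)\<close> at \<open>-1\<close> would force \<open>q^4 = 1\<close> if \<open>q\<close>
  were kept. Two obstacles shape the rest. \<open>qrat\<close> is defined by the expansion of even
  length, but prepending an entry changes the parity; hence expansions of both parities are carried
  along and shown to give the same value. Evaluation at \<open>a = s\<close> cannot be a map on the
  whole field \<open>Qqa\<close>: \<open>s\<close> is algebraic over \<open>Qq\<close>, so some
  nonzero polynomials vanish at \<open>s\<close>. Evaluation is therefore a relation, which has a
  value at every element of \<open>coeff_ring\<close> because only \<open>q\<close>,
  \<open>a\<close> and \<open>q - q^(-1)\<close> are inverted there. As such a partial map does not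
  respect quotients in general, base change of webs is checked coefficient by coefficient. Finally
  \<open>a\<close> must stay invertible, so the existence of the family rests on
  \<open>qdelta x\<close> being nonzero.\<close>

locale ring_map =
  fixes h :: "'a::idom \<Rightarrow> 'b::field"
  assumes map_1: "h 1 = 1"
    and map_add: "h (x + y) = h x + h y"
    and map_mult: "h (x * y) = h x * h y"
begin

lemma map_0: "h 0 = 0"
  by (metis add.right_neutral add_left_cancel map_add)

lemma map_uminus: "h (- x) = - h x"
  using map_add[of x "- x"] map_0 by (simp add: eq_neg_iff_add_eq_0 add.commute)

lemma map_diff: "h (x - y) = h x - h y"
  using map_add[of x "- y"] map_uminus[of y] by simp

lemma map_power: "h (x ^ n) = h x ^ n"
  by (induction n) (simp_all add: map_1 map_mult)

lemma map_prod: "h (prod f A) = (\<Prod>i\<in>A. h (f i))"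
  by (induction A rule: infinite_finite_induct) (simp_all add: map_1 map_mult)

end

locale field_map = ring_map h for h :: "'a::field \<Rightarrow> 'b::field"
begin

lemma map_eq_0: "h x = 0 \<longleftrightarrow> x = 0"
proof
  assume "h x = 0"
  show "x = 0"
  proof (rule ccontr)
    assume "x \<noteq> 0"
    then have "h x * h (inverse x) = 1"
      using map_mult[of x "inverse x"] by (simp add: map_1)
    then show False using \<open>h x = 0\<close> by simp
  qed
qed (simp add: map_0)

lemma map_inverse: "h (inverse x) = inverse (h x)"
proof (cases "x = 0")
  case False
  then have "h x * h (inverse x) = 1"
    using map_mult[of x "inverse x"] by (simp add: map_1)
  then show ?thesis by (metis inverse_unique)
qed (simp add: map_0)

lemma map_divide: "h (x / y) = h x / h y"
  by (simp add: divide_inverse map_mult map_inverse)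

lemma map_power_int: "h (x powi n) = h x powi n"
  by (cases n rule: int_cases2) (simp_all add: map_power map_inverse power_int_minus)

lemma map_qint: "h (qint q n) = qint (h q) n"
  by (simp add: qint_def map_divide map_diff map_power_int map_power map_1)

lemma map_qbinom: "h (qbinom q n k) = qbinom (h q) n k"
  by (simp add: qbinom_def map_divide map_prod map_qint)

lemma map_qcfrac: "h (qcfrac q as) = qcfrac (h q) as"
  by (induction q as rule: qcfrac.induct)
    (simp_all add: map_0 map_qint map_add map_divide map_power_int map_inverse)

end

text \<open>Evaluation at \<open>s\<close> is only partially defined on fractions, hence a relation.\<close>

definition fract_eval :: "('a::idom \<Rightarrow> 'b::field) \<Rightarrow> 'b \<Rightarrow> 'a poly fract \<Rightarrow> 'b \<Rightarrow> bool" where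
  "fract_eval h s f z \<longleftrightarrow> (\<exists>u v. poly (map_poly h v) s \<noteq> 0 \<and> f = to_fract u / to_fract v \<and>
     z = poly (map_poly h u) s / poly (map_poly h v) s)"

context ring_map
begin

abbreviation peval :: "'b \<Rightarrow> 'a poly \<Rightarrow> 'b" where
  "peval s p \<equiv> poly (map_poly h p) s"

lemma peval_pCons: "peval s (pCons c p) = h c + s * peval s p"
  by (simp add: map_poly_pCons map_0)

lemma peval_add: "peval s (u + v) = peval s u + peval s v"
  by (induction u v rule: poly_induct2)
    (simp_all only: add_pCons peval_pCons map_add, simp_all add: algebra_simps)

lemma peval_smult: "peval s (smult c u) = h c * peval s u"
  by (induction u) (simp_all only: smult_pCons peval_pCons map_mult, simp_all add: algebra_simps)

lemma peval_mult: "peval s (u * v) = peval s u * peval s v"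
  by (induction u)
    (simp_all only: mult_pCons_left peval_add peval_smult peval_pCons, simp_all add: algebra_simps map_0)

lemma peval_uminus: "peval s (- u) = - peval s u"
  using peval_add[of u "- u" s] by (simp add: eq_neg_iff_add_eq_0 add.commute)

lemma fract_evalI:
  "peval s v \<noteq> 0 \<Longrightarrow> f = to_fract u / to_fract v \<Longrightarrow> z = peval s u / peval s v \<Longrightarrow> fract_eval h s f z"
  unfolding fract_eval_def by blast

lemma fract_evalE:
  assumes "fract_eval h s f z"
  obtains u v where "peval s v \<noteq> 0" "v \<noteq> 0" "f = to_fract u / to_fract v" "z = peval s u / peval s v"
  using assms unfolding fract_eval_def by (metis map_poly_0 poly_0)

text \<open>Two representations satisfy \<open>u * v' = u' * v\<close> between polynomials, where
  evaluation is total and multiplicative.\<close>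

lemma fract_eval_unique:
  assumes "fract_eval h s f z" "fract_eval h s f z'"
  shows "z = z'"
proof -
  from assms(1) obtain u v where uv: "peval s v \<noteq> 0" "v \<noteq> 0" "f = to_fract u / to_fract v"
    "z = peval s u / peval s v" by (rule fract_evalE)
  from assms(2) obtain u' v' where uv': "peval s v' \<noteq> 0" "v' \<noteq> 0" "f = to_fract u' / to_fract v'"
    "z' = peval s u' / peval s v'" by (rule fract_evalE)
  have "to_fract (u * v') = to_fract (u' * v)"
    using uv(2,3) uv'(2,3) by (simp add: field_simps)
  then have "u * v' = u' * v" by (simp only: to_fract_eq_iff)
  then have "peval s u * peval s v' = peval s u' * peval s v" by (metis peval_mult)
  then show ?thesis using uv(1) uv'(1) unfolding uv(4) uv'(4) by (simp add: frac_eq_eq)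
qed

lemma fract_eval_to_fract: "fract_eval h s (to_fract u) (peval s u)"
  by (rule fract_evalI[where v = 1 and u = u]) (simp_all add: map_1)

lemma fract_eval_const: "fract_eval h s (to_fract [:c:]) (h c)"
  using fract_eval_to_fract[of s "[:c:]"] by (simp only: peval_pCons) simp

lemma fract_eval_1: "fract_eval h s 1 1"
  using fract_eval_to_fract[of s 1] by (simp add: map_1)

lemma fract_eval_0: "fract_eval h s 0 0"
  using fract_eval_to_fract[of s 0] by simp

lemma fract_eval_var: "fract_eval h s (to_fract [:0, 1:]) s"
  using fract_eval_to_fract[of s "[:0, 1:]"] by (simp only: peval_pCons map_0 map_1) simp

lemma fract_eval_add:
  assumes "fract_eval h s f z" "fract_eval h s f' z'"
  shows "fract_eval h s (f + f') (z + z')"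
proof -
  from assms(1) obtain u v where uv: "peval s v \<noteq> 0" "v \<noteq> 0" "f = to_fract u / to_fract v"
    "z = peval s u / peval s v" by (rule fract_evalE)
  from assms(2) obtain u' v' where uv': "peval s v' \<noteq> 0" "v' \<noteq> 0" "f' = to_fract u' / to_fract v'"
    "z' = peval s u' / peval s v'" by (rule fract_evalE)
  show ?thesis
    by (rule fract_evalI[where v = "v * v'" and u = "u * v' + u' * v"])
      (use uv uv' in \<open>simp_all add: peval_add peval_mult add_frac_eq\<close>)
qed

lemma fract_eval_mult:
  assumes "fract_eval h s f z" "fract_eval h s f' z'"
  shows "fract_eval h s (f * f') (z * z')"
proof -
  from assms(1) obtain u v where uv: "peval s v \<noteq> 0" "v \<noteq> 0" "f = to_fract u / to_fract v"
    "z = peval s u / peval s v" by (rule fract_evalE)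
  from assms(2) obtain u' v' where uv': "peval s v' \<noteq> 0" "v' \<noteq> 0" "f' = to_fract u' / to_fract v'"
    "z' = peval s u' / peval s v'" by (rule fract_evalE)
  show ?thesis
    by (rule fract_evalI[where v = "v * v'" and u = "u * u'"])
      (use uv uv' in \<open>simp_all add: peval_mult\<close>)
qed

lemma fract_eval_inverse:
  assumes "fract_eval h s f z" "z \<noteq> 0"
  shows "fract_eval h s (inverse f) (inverse z)"
proof -
  from assms(1) obtain u v where uv: "peval s v \<noteq> 0" "v \<noteq> 0" "f = to_fract u / to_fract v"
    "z = peval s u / peval s v" by (rule fract_evalE)
  show ?thesis
    by (rule fract_evalI[where v = u and u = v]) (use uv assms(2) in auto)
qed

lemma fract_eval_uminus:
  assumes "fract_eval h s f z"
  shows "fract_eval h s (- f) (- z)"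
proof -
  from assms(1) obtain u v where uv: "peval s v \<noteq> 0" "v \<noteq> 0" "f = to_fract u / to_fract v"
    "z = peval s u / peval s v" by (rule fract_evalE)
  show ?thesis
    by (rule fract_evalI[where v = v and u = "- u"]) (use uv in \<open>simp_all add: peval_uminus\<close>)
qed

lemma fract_eval_diff:
  "fract_eval h s f z \<Longrightarrow> fract_eval h s f' z' \<Longrightarrow> fract_eval h s (f - f') (z - z')"
  using fract_eval_add[OF _ fract_eval_uminus, of s f z f' z'] by simp

lemma fract_eval_divide:
  "fract_eval h s f z \<Longrightarrow> fract_eval h s f' z' \<Longrightarrow> z' \<noteq> 0 \<Longrightarrow> fract_eval h s (f / f') (z / z')"
  using fract_eval_mult[OF _ fract_eval_inverse, of s f z f' z'] by (simp add: divide_inverse)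

lemma fract_eval_power: "fract_eval h s f z \<Longrightarrow> fract_eval h s (f ^ n) (z ^ n)"
  by (induction n) (simp_all add: fract_eval_1 fract_eval_mult)

lemma fract_eval_power_int:
  "fract_eval h s f z \<Longrightarrow> z \<noteq> 0 \<Longrightarrow> fract_eval h s (f powi n) (z powi n)"
  by (cases n rule: int_cases2)
    (simp_all add: fract_eval_power fract_eval_inverse power_int_minus)

end

section \<open>The substitution \<open>q \<mapsto> q\<^sup>-\<^sup>1\<close>\<close>

lemma ring_map_of_int: "ring_map (of_int :: int \<Rightarrow> 'a::field)"
  by standard simp_all

lemma field_map_to_ac: "field_map (to_ac :: 'a::field \<Rightarrow> 'a alg_closure)"
  by standard simp_all

lemma to_fract_of_nat: "to_fract (of_nat n) = of_nat n"
  by (induction n) simp_all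

lemma to_fract_of_int: "to_fract (of_int n) = of_int n"
  by (cases n rule: int_cases2) (simp_all add: to_fract_of_nat)

text \<open>In particular \<open>qvar\<close> is transcendental: an integer polynomial that vanishes
  there is zero.\<close>

lemma poly_of_int_qvar: "poly (map_poly of_int p) qvar = to_fract p"
proof (induction p)
  case (pCons c p)
  interpret ring_map "of_int :: int \<Rightarrow> Qq" by (rule ring_map_of_int)
  have "to_fract (pCons c p) = to_fract (of_int c + [:0, 1:] * p)"
    by (simp add: of_int_poly)
  then show ?case
    using pCons by (simp only: peval_pCons to_fract_add to_fract_mult to_fract_of_int qvar_def)
qed simp

lemma qvar_nonzero: "qvar \<noteq> 0"
  by (simp add: qvar_def)

lemma poly_of_int_qvar_eq_0:
  assumes "e \<in> {1, - 1}" "poly (map_poly of_int p) (qvar powi e) = 0"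
  shows "p = 0"
proof (cases "e = 1")
  case True
  then show ?thesis using assms(2) by (simp add: poly_of_int_qvar)
next
  case False
  let ?P = "map_poly of_int p :: Qq poly"
  have "qvar powi e = inverse qvar" using False assms(1) by (auto simp: power_int_minus)
  \<comment> \<open>A zero at \<open>q^(-1)\<close> becomes a zero of the reversed polynomial at
    \<open>q\<close>, where transcendence applies.\<close>
  then have "poly (reflect_poly ?P) qvar = 0"
    using assms(2) by (simp add: poly_reflect_poly_nz qvar_nonzero)
  moreover have "reflect_poly ?P = map_poly of_int (reflect_poly p)"
    by (rule poly_eqI) (simp add: coeff_reflect_poly coeff_map_poly degree_map_poly)
  ultimately show ?thesis by (simp add: poly_of_int_qvar)
qed

text \<open>\<open>qsubst\<close> is computed from one particular quotient. Membership in the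
  single-valued relation \<open>fract_eval\<close> frees it from that choice and yields the
  homomorphism property.\<close>

lemma fract_eval_qsubst:
  assumes "e \<in> {1, - 1}"
  shows "fract_eval of_int (qvar powi e) f (qsubst e f)"
  unfolding fract_eval_def qsubst_def
proof (intro exI conjI)
  show "poly (map_poly of_int (snd (quot_of_fract f))) (qvar powi e) \<noteq> 0"
    using poly_of_int_qvar_eq_0[OF assms] snd_quot_of_fract_nonzero by blast
  show "f = to_fract (fst (quot_of_fract f)) / to_fract (snd (quot_of_fract f))"
    by (simp flip: Fract_conv_to_fract)
qed (simp add: case_prod_unfold Let_def)

lemma field_map_qsubst:
  assumes "e \<in> {1, - 1}"
  shows "field_map (qsubst e)"
proof -
  interpret ring_map "of_int :: int \<Rightarrow> Qq" by (rule ring_map_of_int)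
  note ev = fract_eval_qsubst[OF assms]
  show ?thesis
    by standard
      (blast intro: fract_eval_unique[OF ev] fract_eval_1 fract_eval_add fract_eval_mult ev)+
qed

lemma qsubst_qvar: "e \<in> {1, - 1} \<Longrightarrow> qsubst e qvar = qvar powi e"
proof -
  interpret ring_map "of_int :: int \<Rightarrow> Qq" by (rule ring_map_of_int)
  assume "e \<in> {1, - 1}"
  from fract_eval_unique[OF fract_eval_qsubst[OF this]] fract_eval_var
  show ?thesis unfolding qvar_def by blast
qed

text \<open>The field is generated by \<open>qvar\<close>. This identifies composites of
  substitutions with the identity without computing normalized quotients.\<close>

lemma field_map_fixing_qvar:
  fixes h :: "Qq \<Rightarrow> Qq"
  assumes "field_map h" "h qvar = qvar"
  shows "h f = f"
proof -
  interpret field_map h by fact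
  have nat: "h (of_nat n) = of_nat n" for n
    by (induction n) (simp_all add: map_0 map_1 map_add)
  have int: "h (of_int n) = of_int n" for n
    by (cases n rule: int_cases2) (simp_all add: nat map_uminus)
  have poly: "h (to_fract p) = to_fract p" for p
  proof -
    interpret I: ring_map "of_int :: int \<Rightarrow> Qq" by (rule ring_map_of_int)
    have "h (poly (map_poly of_int p) qvar) = poly (map_poly of_int p) qvar"
      by (induction p) (simp_all add: map_0 I.peval_pCons map_add map_mult int assms(2))
    then show ?thesis by (simp only: poly_of_int_qvar)
  qed
  have "f = to_fract (fst (quot_of_fract f)) / to_fract (snd (quot_of_fract f))"
    by (simp flip: Fract_conv_to_fract)
  then show ?thesis using poly map_divide by metis
qed

interpretation bar: field_map "qsubst (- 1)"
  by (rule field_map_qsubst) simp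

lemma bar_qvar: "qsubst (- 1) qvar = inverse qvar"
  by (simp add: qsubst_qvar power_int_minus)

lemma bar_bar: "qsubst (- 1) (qsubst (- 1) f) = f"
proof -
  have "field_map (\<lambda>f. qsubst (- 1) (qsubst (- 1) f))"
    by standard (simp_all add: bar.map_1 bar.map_add bar.map_mult)
  from field_map_fixing_qvar[OF this] show ?thesis
    by (simp add: bar_qvar bar.map_inverse)
qed

lemma qsubst_1: "qsubst 1 f = f"
  by (rule field_map_fixing_qvar) (simp_all add: field_map_qsubst qsubst_qvar)

text \<open>Positivity at \<open>q = 2\<close> survives the operations of a continued fraction with positive entries, so
  none of its denominators vanishes.\<close>

definition qpos :: "Qq \<Rightarrow> bool" where
  "qpos f \<longleftrightarrow> (\<exists>z::rat. z > 0 \<and> fract_eval of_int 2 f z)"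

interpretation at2: ring_map "of_int :: int \<Rightarrow> rat"
  by (rule ring_map_of_int)

lemma qpos_1: "qpos 1"
  unfolding qpos_def using at2.fract_eval_1 zero_less_one by blast

lemma qpos_qvar: "qpos qvar"
  unfolding qpos_def qvar_def using at2.fract_eval_var zero_less_numeral by blast

lemma qpos_add: "qpos f \<Longrightarrow> qpos g \<Longrightarrow> qpos (f + g)"
  unfolding qpos_def using at2.fract_eval_add add_pos_pos by blast

lemma qpos_mult: "qpos f \<Longrightarrow> qpos g \<Longrightarrow> qpos (f * g)"
  unfolding qpos_def using at2.fract_eval_mult mult_pos_pos by blast

lemma qpos_inverse: "qpos f \<Longrightarrow> qpos (inverse f)"
  unfolding qpos_def using at2.fract_eval_inverse by (metis less_irrefl positive_imp_inverse_positive)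

lemma qpos_nonzero: "qpos f \<Longrightarrow> f \<noteq> 0"
  unfolding qpos_def using at2.fract_eval_0 at2.fract_eval_unique by (metis less_irrefl)

lemma qpos_power: "qpos f \<Longrightarrow> qpos (f ^ n)"
  by (induction n) (simp_all add: qpos_1 qpos_mult)

lemma qpos_power_int: "qpos f \<Longrightarrow> qpos (f powi n)"
  by (cases n rule: int_cases2) (simp_all add: qpos_power qpos_inverse power_int_minus)

text \<open>Here the evaluation point has to exceed 1. This also makes
  \<open>1 + (q^2 - 1) * {x}\<close> positive for positive \<open>x\<close>, as used for
  \<open>qdelta_nonzero\<close>.\<close>

lemma qpos_qvar_minus_1: "qpos (qvar\<^sup>2 - 1)"
proof -
  have "fract_eval of_int 2 (qvar\<^sup>2 - 1) ((2::rat)\<^sup>2 - 1)"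
    unfolding qvar_def
    by (intro at2.fract_eval_diff at2.fract_eval_power at2.fract_eval_1 at2.fract_eval_var)
  then show ?thesis unfolding qpos_def by force
qed

section \<open>Continued fractions and \<open>q\<close>-rationals\<close>

lemma qint_0: "qint q 0 = 0"
  by (simp add: qint_def)

lemma qint_1: "q\<^sup>2 \<noteq> 1 \<Longrightarrow> qint q 1 = 1"
  by (simp add: qint_def)

lemma qint_add1:
  assumes "q \<noteq> 0" "q\<^sup>2 \<noteq> (1::'k::field)"
  shows "qint q (n + 1) = q\<^sup>2 * qint q n + 1"
proof -
  have "q powi (2 * (n + 1)) = q\<^sup>2 * q powi (2 * n)"
    using assms(1) by (simp add: power_int_add distrib_left)
  then show ?thesis using assms by (simp add: qint_def field_simps)
qed

lemma qint_add1_powi: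
  assumes "q \<noteq> 0" "q\<^sup>2 \<noteq> (1::'k::field)"
  shows "qint q (n + 1) = qint q n + q powi (2 * n)"
proof -
  have "q powi (2 * (n + 1)) = q\<^sup>2 * q powi (2 * n)"
    using assms(1) by (simp add: power_int_add distrib_left)
  then show ?thesis using assms by (simp add: qint_def field_simps)
qed

text \<open>Parity is left free, since removing the head changes it; the inductions need a class
  closed under nonempty tails.\<close>

definition cfrac_list :: "int list \<Rightarrow> bool" where
  "cfrac_list as \<longleftrightarrow> as \<noteq> [] \<and> (\<forall>a \<in> set (tl as). a \<ge> 1)"

lemma even_cfrac_expansion_iff:
  "even_cfrac_expansion x as \<longleftrightarrow> cfrac_list as \<and> even (length as) \<and> cfrac_value as = x"
  unfolding even_cfrac_expansion_def cfrac_list_def by blast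

lemma cfrac_value_Cons: "as \<noteq> [] \<Longrightarrow> cfrac_value (a # as) = of_int a + 1 / cfrac_value as"
  by (cases as) auto

lemma qcfrac_Cons: "as \<noteq> [] \<Longrightarrow> qcfrac q (a # as) = qint q a + q powi (2 * a) / qcfrac (inverse q) as"
  by (cases as) auto

lemma cfrac_list_tl: "cfrac_list (a # as) \<Longrightarrow> as \<noteq> [] \<Longrightarrow> cfrac_list as"
  by (cases as) (auto simp: cfrac_list_def)

lemma cfrac_value_ge_1: "as \<noteq> [] \<Longrightarrow> \<forall>a \<in> set as. a \<ge> 1 \<Longrightarrow> cfrac_value as \<ge> 1"
proof (induction as rule: cfrac_value.induct)
  case (3 a b as)
  then have "cfrac_value (b # as) \<ge> 1" by simp
  then have "1 / cfrac_value (b # as) > 0" by simp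
  moreover have "of_int a \<ge> (1::rat)" using 3 by simp
  ultimately show ?case unfolding cfrac_value.simps by linarith
qed auto

lemma cfrac_value_gt_1:
  assumes "\<forall>a \<in> set (a # as). a \<ge> 1" "as \<noteq> []"
  shows "cfrac_value (a # as) > 1"
proof -
  have "cfrac_value as \<ge> 1" using assms by (intro cfrac_value_ge_1) auto
  then have "1 / cfrac_value as > 0" by simp
  moreover have "of_int a \<ge> (1::rat)" using assms by simp
  ultimately show ?thesis unfolding cfrac_value_Cons[OF assms(2)] by linarith
qed

text \<open>Tails have value at least 1, so both values lie within \<open>(head, head + 1]\<close>
  and the heads agree. Equal parity removes the only ambiguity, a final \<open>n\<close> against
  \<open>n - 1, 1\<close>.\<close>

lemma cfrac_list_unique:
  "cfrac_list as \<Longrightarrow> cfrac_list bs \<Longrightarrow> even (length as) = even (length bs) \<Longrightarrow>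
   cfrac_value as = cfrac_value bs \<Longrightarrow> as = bs"
proof (induction as arbitrary: bs)
  case (Cons a as)
  from Cons.prems(2) obtain b cs where bs: "bs = b # cs" by (auto simp: cfrac_list_def neq_Nil_conv)
  have pos: "\<forall>a \<in> set as. a \<ge> 1" "\<forall>a \<in> set cs. a \<ge> 1"
    using Cons.prems bs by (auto simp: cfrac_list_def)
  \<comment> \<open>If one list ends here, the tail of the other has even length, hence two or more
    entries and a value above 1; its reciprocal lies strictly between 0 and 1 and cannot be a
    difference of integers.\<close>
  have longer: False
    if "even (length ds)" "ds \<noteq> []" "\<forall>a \<in> set ds. a \<ge> 1" "of_int m = of_int n + 1 / cfrac_value ds"
    for m n :: int and ds
  proof -
    obtain d es where ds: "ds = d # es" using \<open>ds \<noteq> []\<close> by (cases ds) auto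
    then have "es \<noteq> []" using \<open>even (length ds)\<close> by auto
    have "cfrac_value ds > 1" using that(3) \<open>es \<noteq> []\<close> unfolding ds by (intro cfrac_value_gt_1)
    then have "1 / cfrac_value ds > 0" "1 / cfrac_value ds < 1" by simp_all
    then have "of_int (m - n) > (0::rat)" "of_int (m - n) < (1::rat)"
      using that(4) by simp_all
    then have "m - n > 0" "m - n < 1" by (simp_all only: of_int_0_less_iff of_int_less_1_iff)
    then show False by simp
  qed
  show ?case
  proof (cases "as = [] \<or> cs = []")
    case True
    then show ?thesis
      using Cons.prems(3,4) bs pos longer[of as b a] longer[of cs a b]
      by (cases "as = []"; cases "cs = []") (auto simp: cfrac_value_Cons)
  next
    case False
    then have ge: "cfrac_value as \<ge> 1" "cfrac_value cs \<ge> 1"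
      using pos by (auto intro: cfrac_value_ge_1)
    then have "1 / cfrac_value as > 0" "1 / cfrac_value as \<le> 1"
      "1 / cfrac_value cs > 0" "1 / cfrac_value cs \<le> 1" by simp_all
    moreover have eq: "of_int a + 1 / cfrac_value as = of_int b + 1 / cfrac_value cs"
      using Cons.prems(4) False by (simp add: bs cfrac_value_Cons)
    ultimately have "of_int (a - b) < (1::rat)" "of_int (b - a) < (1::rat)"
      unfolding of_int_diff by linarith+
    then have "a - b < 1" "b - a < 1" by (simp_all only: of_int_less_1_iff)
    then have ab: "a = b" by simp
    have "as = cs"
      using Cons.prems bs False eq ab by (intro Cons.IH) (auto dest: cfrac_list_tl)
    then show ?thesis by (simp add: ab bs)
  qed
qed (simp add: cfrac_list_def)

text \<open>The last entry \<open>n\<close> may be replaced by \<open>n - 1, 1\<close>, which changes the parity of the length.\<close>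

lemma cfrac_expansions_fraction:
  assumes "d > 0"
  shows "\<exists>as bs. cfrac_list as \<and> even (length as) \<and> cfrac_value as = of_int p / of_nat d \<and>
    cfrac_list bs \<and> odd (length bs) \<and> cfrac_value bs = of_int p / of_nat d \<and>
    (\<forall>q::'k::field. q \<noteq> 0 \<longrightarrow> q\<^sup>2 \<noteq> 1 \<longrightarrow> qcfrac q as = qcfrac q bs)"
  using assms
proof (induction d arbitrary: p rule: less_induct)
  case (less d)
  \<comment> \<open>One step of the Euclidean algorithm: \<open>p / d = n + 1 / (d / r)\<close>,
    with the smaller denominator \<open>r\<close>.\<close>
  define n r where "n = p div int d" and "r = nat (p mod int d)"
  have r: "int r = p mod int d" "r < d" using less.prems by (simp_all add: r_def nat_less_iff)
  have p: "p = n * int d + int r" by (simp add: n_def r(1))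
  show ?case
  proof (cases "r = 0")
    case True
    have val: "of_int p / of_nat d = (of_int n :: rat)"
      using less.prems True by (simp add: p)
    have "qcfrac q [n - 1, 1] = qcfrac q [n]" if "q \<noteq> 0" "q\<^sup>2 \<noteq> 1" for q :: 'k
    proof -
      have "qint (inverse q) 1 = 1" using that by (intro qint_1) (simp add: power_inverse)
      then show ?thesis using qint_add1_powi[OF that, of "n - 1"] by simp
    qed
    then show ?thesis
      by (intro exI[of _ "[n - 1, 1]"] exI[of _ "[n]"]) (simp add: cfrac_list_def val)
  next
    case False
    from less.IH[OF r(2), of "int d"] False obtain as bs where IH:
      "cfrac_list as" "even (length as)" "cfrac_value as = of_nat d / of_nat r"
      "cfrac_list bs" "odd (length bs)" "cfrac_value bs = of_nat d / of_nat r"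
      "\<forall>q::'k. q \<noteq> 0 \<longrightarrow> q\<^sup>2 \<noteq> 1 \<longrightarrow> qcfrac q as = qcfrac q bs" by auto
    have "of_int p = of_int n * of_nat d + (of_nat r :: rat)"
      using arg_cong[OF p, of "of_int :: int \<Rightarrow> rat"] by simp
    then have val: "of_int n + 1 / (of_nat d / of_nat r) = (of_int p / of_nat d :: rat)"
      using less.prems by (simp add: add_divide_distrib)
    have gt: "of_nat d / of_nat r > (1::rat)" using False r(2) by simp
    \<comment> \<open>An expansion of \<open>d / r > 1\<close> has a positive head as well, so it
      may serve as a tail.\<close>
    have all: "\<forall>c \<in> set cs. c \<ge> 1" if cs: "cfrac_list cs" "cfrac_value cs = of_nat d / of_nat r" for cs
    proof -
      obtain c cs' where Cons: "cs = c # cs'" using cs(1) by (auto simp: cfrac_list_def neq_Nil_conv)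
      have tl: "\<forall>c \<in> set cs'. c \<ge> 1" using cs(1) by (simp add: cfrac_list_def Cons)
      have "c \<ge> 1"
      proof (cases "cs' = []")
        case True
        then have "of_int c > (1::rat)" using gt cs(2) by (simp add: Cons)
        then show ?thesis by simp
      next
        case False
        then have "cfrac_value cs' \<ge> 1" using tl by (intro cfrac_value_ge_1)
        then have "1 / cfrac_value cs' \<le> 1" by simp
        then have "of_int c > (0::rat)" using gt cs(2) False by (simp add: Cons cfrac_value_Cons)
        then show ?thesis by simp
      qed
      then show ?thesis using tl Cons by simp
    qed
    have "cfrac_list (n # as)" "cfrac_list (n # bs)"
      using all IH by (simp_all add: cfrac_list_def)
    moreover have "as \<noteq> []" "bs \<noteq> []" using IH by (simp_all add: cfrac_list_def)
    moreover have "inverse q \<noteq> 0" "(inverse q)\<^sup>2 \<noteq> 1" if "q \<noteq> 0" "q\<^sup>2 \<noteq> 1" for q :: 'k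
      using that by (simp_all add: power_inverse)
    \<comment> \<open>Prepending \<open>n\<close> swaps the parities: the odd expansion
      \<open>bs\<close> supplies the new even one.\<close>
    ultimately show ?thesis using IH val
      by (intro exI[of _ "n # bs"] exI[of _ "n # as"]) (simp add: cfrac_value_Cons qcfrac_Cons)
  qed
qed

lemma cfrac_expansions:
  obtains as bs where "cfrac_list as" "even (length as)" "cfrac_value as = x"
    "cfrac_list bs" "odd (length bs)" "cfrac_value bs = x"
    "\<And>q::'k::field. q \<noteq> 0 \<Longrightarrow> q\<^sup>2 \<noteq> 1 \<Longrightarrow> qcfrac q as = qcfrac q bs"
proof -
  obtain p d where pd: "quotient_of x = (p, d)" by (cases "quotient_of x")
  then have "d > 0" by (rule quotient_of_denom_pos)
  moreover have "x = of_int p / of_int d" using pd by (rule quotient_of_div)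
  ultimately have "nat d > 0" "x = of_int p / of_nat (nat d)" by simp_all
  with cfrac_expansions_fraction[of "nat d" p] that show thesis by metis
qed

lemma qvar_power2_neq_1: "qvar\<^sup>2 \<noteq> 1"
  using qpos_nonzero[OF qpos_qvar_minus_1] by simp

lemma qvar_ne: "qvar \<noteq> 0" "qvar\<^sup>2 - 1 \<noteq> 0" "inverse qvar \<noteq> 0" "(inverse qvar)\<^sup>2 \<noteq> 1"
  using qvar_nonzero qvar_power2_neq_1 by (simp_all add: power_inverse)

text \<open>Replaces the definite description in \<open>qrat\<close> by whichever expansion is
  convenient, of either parity.\<close>

lemma qrat_cfrac_value:
  assumes "cfrac_list as"
  shows "qrat (cfrac_value as) = qcfrac qvar as"
proof -
  obtain bs cs where exp: "cfrac_list bs" "even (length bs)" "cfrac_value bs = cfrac_value as"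
    "cfrac_list cs" "odd (length cs)" "cfrac_value cs = cfrac_value as"
    "\<And>q::Qq. q \<noteq> 0 \<Longrightarrow> q\<^sup>2 \<noteq> 1 \<Longrightarrow> qcfrac q bs = qcfrac q cs"
    using cfrac_expansions by blast
  have "(THE as'. even_cfrac_expansion (cfrac_value as) as') = bs"
    using exp cfrac_list_unique by (intro the_equality) (auto simp: even_cfrac_expansion_iff)
  then have "qrat (cfrac_value as) = qcfrac qvar bs" by (simp add: qrat_def)
  moreover have "as = (if even (length as) then bs else cs)"
    using exp assms by (auto intro: cfrac_list_unique)
  ultimately show ?thesis using exp(7) qvar_nonzero qvar_power2_neq_1 by metis
qed

lemma cfrac_expansion_exists: "\<exists>as. cfrac_list as \<and> cfrac_value as = x"
  using cfrac_expansions by blast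

section \<open>Functional equations and positivity of the q-rationals\<close>

lemma qrat_add1: "qrat (x + 1) = qvar\<^sup>2 * qrat x + 1"
proof -
  obtain as where as: "cfrac_list as" "cfrac_value as = x" using cfrac_expansion_exists by blast
  then obtain a bs where [simp]: "as = a # bs" by (auto simp: cfrac_list_def neq_Nil_conv)
  have "cfrac_list ((a + 1) # bs)" using as by (simp add: cfrac_list_def)
  moreover have "cfrac_value ((a + 1) # bs) = x + 1"
    using as by (cases "bs = []") (auto simp: cfrac_value_Cons)
  ultimately have "qrat (x + 1) = qcfrac qvar ((a + 1) # bs)" using qrat_cfrac_value by metis
  also have "\<dots> = qvar\<^sup>2 * qcfrac qvar as + 1"
  proof -
    have "qvar powi (2 * (a + 1)) = qvar\<^sup>2 * qvar powi (2 * a)"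
      by (simp add: power_int_add distrib_left qvar_nonzero)
    then show ?thesis
      by (cases "bs = []")
        (simp_all add: qcfrac_Cons qint_add1 qvar_nonzero qvar_power2_neq_1 distrib_left)
  qed
  finally show ?thesis using as qrat_cfrac_value by metis
qed

lemma qpos_qint: "n \<ge> 1 \<Longrightarrow> q = qvar \<or> q = inverse qvar \<Longrightarrow> qpos (qint q n)"
proof (induction n rule: int_ge_induct)
  case base
  then show ?case using qvar_ne qvar_power2_neq_1 by (auto simp: qint_1 qpos_1)
next
  case (step i)
  then have "qint q (i + 1) = q\<^sup>2 * qint q i + 1"
    using qvar_ne qvar_power2_neq_1 by (intro qint_add1) auto
  then show ?case using step
    by (auto intro!: qpos_add qpos_mult qpos_power qpos_1 qpos_qvar qpos_inverse)
qed

text \<open>Both \<open>qvar\<close> and its inverse are covered, because each level of the fraction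
  switches between them.\<close>

lemma qpos_qcfrac:
  "as \<noteq> [] \<Longrightarrow> \<forall>a \<in> set as. a \<ge> 1 \<Longrightarrow> q = qvar \<or> q = inverse qvar \<Longrightarrow> qpos (qcfrac q as)"
proof (induction q as rule: qcfrac.induct)
  case (3 q a b as)
  then have "qpos (qcfrac (inverse q) (b # as))" by auto
  moreover have "qpos q" using 3 by (auto intro: qpos_inverse qpos_qvar)
  ultimately show ?case using 3
    by (auto simp: divide_inverse intro!: qpos_add qpos_qint qpos_mult qpos_inverse qpos_power_int)
qed (auto intro: qpos_qint)

text \<open>The odd length is essential: the even expansion of 1 is \<open>[0, 1]\<close>. In odd
  length a nonempty tail has at least two entries, hence value above 1, which leaves more than 0 for
  the head.\<close>

lemma cfrac_expansion_ge_1: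
  assumes "x \<ge> 1"
  obtains as where "as \<noteq> []" "\<forall>a \<in> set as. a \<ge> 1" "cfrac_value as = x"
proof -
  obtain as where as: "cfrac_list as" "odd (length as)" "cfrac_value as = x"
    using cfrac_expansions by blast
  then obtain a bs where [simp]: "as = a # bs" by (auto simp: cfrac_list_def neq_Nil_conv)
  have tl: "\<forall>a \<in> set bs. a \<ge> 1" using as by (simp add: cfrac_list_def)
  have "a \<ge> 1"
  proof (cases bs)
    case Nil
    then show ?thesis using as assms by simp
  next
    case (Cons b cs)
    then have "cs \<noteq> []" using as(2) by auto
    then have "cfrac_value bs > 1" using tl cfrac_value_gt_1 Cons by auto
    then have "1 / cfrac_value bs < 1" by simp
    then have "of_int a > (0::rat)" using as(3) assms Cons by (simp add: cfrac_value_Cons)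
    then show ?thesis by simp
  qed
  then show thesis using that[of as] tl as(3) by simp
qed

text \<open>Prepending the entry 0 inverts the number. On the q-side it adds \<open>{0} = 0\<close>,
  has numerator \<open>q^0 = 1\<close>, and passes to the inverse of \<open>q\<close> in the
  tail.\<close>

lemma qrat_inverse_ge_1:
  assumes "x \<ge> 1"
  shows "qrat (1 / x) = 1 / qsubst (- 1) (qrat x)"
proof -
  obtain as where as: "as \<noteq> []" "\<forall>a \<in> set as. a \<ge> 1" "cfrac_value as = x"
    using cfrac_expansion_ge_1 assms by blast
  then have "cfrac_list as" "cfrac_list (0 # as)"
    by (cases as, auto simp: cfrac_list_def)+
  then have "qrat x = qcfrac qvar as" "qrat (1 / x) = qcfrac qvar (0 # as)"
    using qrat_cfrac_value[of as] qrat_cfrac_value[of "0 # as"] as by (simp_all add: cfrac_value_Cons)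
  then show ?thesis
    using as by (simp add: qcfrac_Cons qint_0 bar.map_qcfrac bar_qvar)
qed

text \<open>Since the substitution is an involution, the relation is symmetric in \<open>x\<close>
  and \<open>1 / x\<close>, and one of them is at least 1.\<close>

lemma qrat_inverse_pos:
  assumes "x > 0"
  shows "qrat (1 / x) = 1 / qsubst (- 1) (qrat x)"
proof (cases "x \<ge> 1")
  case False
  then have "qrat (1 / (1 / x)) = 1 / qsubst (- 1) (qrat (1 / x))"
    using assms by (intro qrat_inverse_ge_1) simp
  then have "qrat x = 1 / qsubst (- 1) (qrat (1 / x))" by simp
  then have "qsubst (- 1) (qrat x) = 1 / qrat (1 / x)"
    by (simp only: bar.map_divide bar.map_1 bar_bar)
  then show ?thesis by (metis divide_divide_eq_right div_by_1 mult_1)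
qed (rule qrat_inverse_ge_1)

text \<open>Below 1 the value is the reciprocal of a substituted one, so the case
  \<open>y \<ge> 1\<close> has to give positivity before and after the substitution.\<close>

lemma qpos_qrat:
  assumes "x > 0"
  shows "qpos (qrat x)"
proof -
  have ge_1: "qpos (qrat y) \<and> qpos (qsubst (- 1) (qrat y))" if y: "y \<ge> 1" for y
  proof -
    obtain as where as: "as \<noteq> []" "\<forall>a \<in> set as. a \<ge> 1" "cfrac_value as = y"
      using cfrac_expansion_ge_1[OF y] by metis
    then have "cfrac_list as" by (cases as) (auto simp: cfrac_list_def)
    then have "qrat y = qcfrac qvar as" using qrat_cfrac_value as by metis
    moreover have "qpos (qcfrac qvar as)" "qpos (qcfrac (inverse qvar) as)"
      using as(1,2) by (auto intro: qpos_qcfrac)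
    ultimately show ?thesis by (simp add: bar.map_qcfrac bar_qvar)
  qed
  show ?thesis
  proof (cases "x \<ge> 1")
    case False
    then have "1 / x \<ge> 1" using assms by simp
    then have "qrat (1 / (1 / x)) = 1 / qsubst (- 1) (qrat (1 / x))" by (rule qrat_inverse_ge_1)
    then have "qrat x = inverse (qsubst (- 1) (qrat (1 / x)))" by (simp add: inverse_eq_divide)
    moreover have "qpos (qsubst (- 1) (qrat (1 / x)))" using ge_1[OF \<open>1 / x \<ge> 1\<close>] ..
    ultimately show ?thesis by (simp only: qpos_inverse)
  qed (use ge_1 in blast)
qed

lemma qrat_0: "qrat 0 = 0"
  using qrat_cfrac_value[of "[0]"] by (simp add: cfrac_list_def qint_0)

lemma qrat_of_int: "qrat (of_int n) = qint qvar n"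
  using qrat_cfrac_value[of "[n]"] by (simp add: cfrac_list_def)

lemma qrat_sub1: "qrat (x - 1) = (qrat x - 1) / qvar\<^sup>2"
  using qrat_add1[of "x - 1"] by (simp add: field_simps qvar_nonzero)

lemma int_shift_invariant:
  fixes P :: "rat \<Rightarrow> bool"
  assumes "\<And>x. P (x + 1) \<longleftrightarrow> P x"
  shows "P (x + of_int n) \<longleftrightarrow> P x"
proof (induction n rule: int_induct[of _ 0])
  case (step1 i)
  then show ?case using assms[of "x + of_int i"] by (simp add: add.assoc)
next
  case (step2 i)
  then show ?case using assms[of "x + of_int (i - 1)"] by (simp add: algebra_simps)
qed simp

text \<open>The relation is invariant under \<open>x \<mapsto> x + 1\<close>, and on the unit interval it follows from
  the inversion of the positive rationals \<open>x\<close>, \<open>1 - x\<close> and \<open>1/x - 1\<close>.\<close>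

lemma qrat_uminus: "qrat (- x) = - inverse (qvar\<^sup>2) * qsubst (- 1) (qrat x)"
proof -
  define N where "N x \<longleftrightarrow> qrat (- x) = - inverse (qvar\<^sup>2) * qsubst (- 1) (qrat x)" for x
  have bar_sq: "qsubst (- 1) (qvar\<^sup>2) = inverse (qvar\<^sup>2)"
    by (simp add: bar.map_power bar_qvar power_inverse)
  \<comment> \<open>With \<open>c = q^2\<close> this is the passage from \<open>x + 1\<close> to
    \<open>x\<close>: the shift acts on both sides of the relation by the same affine map
    \<open>y \<mapsto> (y - 1) / c\<close>.\<close>
  have rescale: "(f - 1) / c = - inverse c * (inverse c * g + 1) \<longleftrightarrow> f = - inverse c * g"
    if "c \<noteq> 0" for c f g :: Qq
  proof -
    have "- inverse c * (inverse c * g + 1) = (- inverse c * g - 1) / c"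
      by (simp add: divide_inverse algebra_simps)
    then show ?thesis using that by (simp only: divide_cancel_right) auto
  qed
  have "N (x + 1) \<longleftrightarrow> N x" for x
  proof -
    have "qrat (- (x + 1)) = (qrat (- x) - 1) / qvar\<^sup>2"
      using qrat_sub1[of "- x"] by (simp only: minus_add_distrib diff_conv_add_uminus)
    then show ?thesis
      unfolding N_def qrat_add1 bar.map_add bar.map_mult bar_sq bar.map_1
      using rescale[of "qvar\<^sup>2"] qvar_nonzero by simp
  qed
  then have shift: "N (x + of_int n) \<longleftrightarrow> N x" for x n
    by (rule int_shift_invariant)
  have "N (frac x)"
  proof (cases "frac x = 0")
    case True
    then show ?thesis unfolding True by (simp add: N_def qrat_0 bar.map_0)
  next
    case False
    define t where "t = frac x"
    have t: "t > 0" "t < 1" using False frac_ge_0[of x] frac_lt_1[of x] unfolding t_def by linarith+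
    \<comment> \<open>Both \<open>{t}\<close> and \<open>{1 - t}\<close> can be expressed by
      \<open>Q\<close>, because \<open>1/t = (1/t - 1) + 1\<close> and
      \<open>1/(1 - t) = 1/(1/t - 1) + 1\<close>. Comparing them gives
      \<open>{1 - t} = 1 - {t}\<close> with \<open>q\<close> inverted on the right.\<close>
    define Q where "Q = qrat (1 / t - 1)"
    have t': "1 / t - 1 > 0" using t by simp
    then have Q: "qpos Q" unfolding Q_def by (rule qpos_qrat)
    have Qt: "qrat (1 / t) = qvar\<^sup>2 * Q + 1"
      unfolding Q_def using qrat_add1[of "1 / t - 1"] by simp
    have nz: "Q \<noteq> 0" "qvar\<^sup>2 * Q + 1 \<noteq> 0"
      using Q by (auto intro!: qpos_nonzero qpos_add qpos_mult qpos_power qpos_qvar qpos_1)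
    have "qrat t = 1 / qsubst (- 1) (qrat (1 / t))"
      using qrat_inverse_pos[of "1 / t"] t by simp
    then have bar_t: "qsubst (- 1) (qrat t) = 1 / (qvar\<^sup>2 * Q + 1)"
      by (simp add: bar.map_divide bar.map_1 bar_bar Qt)
    have "qrat (1 / (1 / t - 1)) = 1 / qsubst (- 1) Q"
      unfolding Q_def using t' by (rule qrat_inverse_pos)
    then have "qrat (1 / (1 - t)) = qvar\<^sup>2 / qsubst (- 1) Q + 1"
      using qrat_add1[of "1 / (1 / t - 1)"] t by (simp add: field_simps)
    moreover have "qrat (1 - t) = 1 / qsubst (- 1) (qrat (1 / (1 - t)))"
      using qrat_inverse_pos[of "1 / (1 - t)"] t by simp
    ultimately have "qrat (1 - t) = 1 / (inverse (qvar\<^sup>2) / Q + 1)"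
      by (simp only: bar.map_divide bar.map_add bar.map_1 bar_bar bar_sq)
    also have "\<dots> = 1 - qsubst (- 1) (qrat t)"
      unfolding bar_t using nz qvar_nonzero by (simp add: field_simps)
    finally have "qrat (- t) = - qsubst (- 1) (qrat t) / qvar\<^sup>2"
      using qrat_sub1[of "1 - t"] by simp
    then show ?thesis by (simp add: N_def t_def divide_inverse mult.commute)
  qed
  then have "N x" using shift[of "frac x" "\<lfloor>x\<rfloor>"] by (simp add: frac_def)
  then show ?thesis by (simp add: N_def)
qed

text \<open>For negative \<open>x\<close> the relation for \<open>-x\<close> is conjugated by
  \<open>qrat_uminus\<close>; the signs and powers of \<open>q\<close> from its two uses
  cancel.\<close>

lemma qrat_inverse:
  assumes "x \<noteq> 0"
  shows "qrat (1 / x) = 1 / qsubst (- 1) (qrat x)"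
proof (cases "x > 0")
  case False
  then have "qrat (1 / - x) = 1 / qsubst (- 1) (qrat (- x))"
    using assms by (intro qrat_inverse_pos) simp
  moreover have "qrat (1 / x) = - inverse (qvar\<^sup>2) * qsubst (- 1) (qrat (1 / - x))"
    using qrat_uminus[of "1 / - x"] by simp
  moreover have "qsubst (- 1) (qrat x) = - qvar\<^sup>2 * qrat (- x)"
    using qrat_uminus[of x] qvar_nonzero by simp
  ultimately show ?thesis
    by (simp add: bar.map_divide bar.map_1 bar_bar field_simps)
qed (rule qrat_inverse_pos)

lemma qrat_nonzero:
  assumes "x \<noteq> 0"
  shows "qrat x \<noteq> 0"
proof (cases "x > 0")
  case True
  then show ?thesis using qpos_qrat qpos_nonzero by blast
next
  case False
  then have "qrat (- x) \<noteq> 0" using assms qpos_qrat[of "- x"] qpos_nonzero by auto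
  then show ?thesis using qrat_uminus[of x] bar.map_0 by auto
qed

text \<open>The right-hand side is the solution \<open>a^2\<close> of
  \<open>(a^2 - 1) / (q^2 - 1) = {x}\<close>. This links the stabilized unknot to the root
  \<open>q \<nu> \<delta>\<close>, whose square is \<open>q^2 \<delta>\<close>.\<close>

lemma qdelta_qrat: "qvar\<^sup>2 * qdelta x = 1 + (qvar\<^sup>2 - 1) * qrat x"
  unfolding qdelta_def qrat_sub1 using qvar_nonzero by (simp add: field_simps)

text \<open>The shift by 1 multiplies \<open>qdelta\<close> by \<open>q^2\<close>, so only the
  fractional part matters, and there \<open>{x}\<close> is zero or positive at
  \<open>q = 2\<close>.\<close>

lemma qdelta_nonzero: "qdelta x \<noteq> 0"
proof -
  have eq: "qdelta (x + 1) = qvar\<^sup>2 * qdelta x" for x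
    using qrat_add1[of x] qrat_add1[of "x - 1"] by (simp add: qdelta_def algebra_simps)
  have "qdelta (x + of_int n) = 0 \<longleftrightarrow> qdelta x = 0" for x n
    by (rule int_shift_invariant[where P = "\<lambda>x. qdelta x = 0"]) (simp add: eq qvar_nonzero)
  from this[of "frac x" "\<lfloor>x\<rfloor>"] have "qdelta x = 0 \<longleftrightarrow> qdelta (frac x) = 0"
    by (simp add: frac_def)
  moreover have "qpos (qvar\<^sup>2 * qdelta (frac x))"
  proof (cases "frac x = 0")
    case True
    then show ?thesis unfolding True by (simp add: qdelta_qrat qrat_0 qpos_1)
  next
    case False
    then have "frac x > 0" using frac_ge_0[of x] by linarith
    then show ?thesis unfolding qdelta_qrat
      by (intro qpos_add qpos_1 qpos_mult qpos_qvar_minus_1 qpos_qrat)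
  qed
  ultimately show ?thesis using qpos_nonzero by fastforce
qed

lemma qdelta_of_int: "qdelta (of_int n) = qvar powi (2 * n - 2)"
proof -
  have "qint qvar n = qint qvar (n - 1) + qvar powi (2 * (n - 1))"
    using qint_add1_powi[OF qvar_nonzero qvar_power2_neq_1, of "n - 1"] by simp
  moreover have "qrat (of_int n - 1) = qint qvar (n - 1)"
    using qrat_of_int[of "n - 1"] by simp
  ultimately show ?thesis by (simp add: qdelta_def qrat_of_int)
qed

section \<open>The functional equations determine the \<open>q\<close>-rationals\<close>

lemma qrat_unique:
  fixes v :: "rat \<Rightarrow> Qq"
  assumes nat: "\<And>n::nat. v (of_nat n) = qint qvar (int n)"
    and shift: "\<And>x. v (x + 1) = qvar\<^sup>2 * v x + 1"
    and e: "e \<in> {1, - 1}"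
    and inv: "\<And>x. x \<noteq> 0 \<Longrightarrow> v (1 / x) = qvar powi \<alpha> * (1 / qsubst e (v x))"
  shows "v x = qrat x"
proof -
  \<comment> \<open>\<open>q\<close> is not a root of unity, seen at \<open>q = 2\<close>.\<close>
  have powi_inj: "m = 0" if "qvar powi m = 1" for m
  proof -
    have "fract_eval of_int (2::rat) (qvar powi m) (2 powi m)"
      unfolding qvar_def using at2.fract_eval_power_int[OF at2.fract_eval_var] by simp
    then have "(2::rat) powi m = 1"
      using that at2.fract_eval_1 at2.fract_eval_unique by metis
    moreover have "n = 0" if "(2::rat) ^ n = 1" for n
      using that one_less_power[of "2::rat" n] by (cases "n = 0") auto
    ultimately show ?thesis
      by (cases m rule: int_cases2) (auto simp: power_int_minus)
  qed
  interpret e: field_map "qsubst e" using e by (rule field_map_qsubst)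
  have v1: "v 1 = 1" using nat[of 1] qvar_power2_neq_1 by (simp add: qint_1)
  have v0: "v 0 = 0" using nat[of 0] by (simp add: qint_0)
  have "qvar powi \<alpha> = 1" using inv[of 1] by (simp add: v1 e.map_1)
  then have inv': "v (1 / x) = 1 / qsubst e (v x)" if "x \<noteq> 0" for x
    using inv[OF that] by simp
  have vm1: "v (- 1) = - inverse (qvar\<^sup>2)"
    using shift[of "- 1"] v0 qvar_nonzero by (simp add: field_simps add_eq_0_iff)
  \<comment> \<open>With \<open>e = 1\<close>, the equation at the fixed point \<open>-1\<close>
    would read \<open>q^(-2) = q^2\<close>.\<close>
  have em1: "e = - 1"
  proof (rule ccontr)
    assume "e \<noteq> - 1"
    with e have "e = 1" by simp
    with inv'[of "- 1"] vm1 have "inverse (qvar\<^sup>2) = qvar\<^sup>2" by (simp add: qsubst_1 divide_inverse)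
    then have "qvar\<^sup>2 * qvar\<^sup>2 = 1" using qvar_nonzero by (metis power_not_zero right_inverse)
    then have "qvar powi 4 = 1" by (simp flip: power_add)
    then show False using powi_inj by fastforce
  qed
  \<comment> \<open>The iterated shift has the shape of the outermost level of
    \<open>qcfrac\<close>. Negative \<open>n\<close> is included because the first entry of an
    expansion may be any integer.\<close>
  have shift_int: "v (x + of_int n) = qint qvar n + qvar powi (2 * n) * v x" for x n
  proof (induction n rule: int_induct[of _ 0])
    case (step1 i)
    have "v (x + of_int (i + 1)) = qvar\<^sup>2 * (qint qvar i + qvar powi (2 * i) * v x) + 1"
      using shift[of "x + of_int i"] step1 by (simp add: add.assoc)
    then show ?case
      using qvar_nonzero qint_add1[OF qvar_nonzero qvar_power2_neq_1, of i]
      by (simp add: power_int_add algebra_simps)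
  next
    case (step2 i)
    have "qvar\<^sup>2 * v (x + of_int (i - 1)) + 1 = qint qvar i + qvar powi (2 * i) * v x"
      using shift[of "x + of_int (i - 1)"] step2 by (simp add: algebra_simps)
    moreover have "qint qvar i = qvar\<^sup>2 * qint qvar (i - 1) + 1"
      using qint_add1[OF qvar_nonzero qvar_power2_neq_1, of "i - 1"] by simp
    moreover have "qvar powi (2 * i) = qvar\<^sup>2 * qvar powi (2 * (i - 1))"
      using qvar_nonzero by (simp add: power_int_diff right_diff_distrib)
    ultimately have "qvar\<^sup>2 * v (x + of_int (i - 1)) =
        qvar\<^sup>2 * (qint qvar (i - 1) + qvar powi (2 * (i - 1)) * v x)"
      by (simp add: algebra_simps)
    then show ?case using qvar_nonzero by simp
  qed (simp add: qint_0)
  have "cfrac_list as \<Longrightarrow> v (cfrac_value as) = qcfrac qvar as" for as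
  proof (induction as)
    case (Cons a as)
    show ?case
    proof (cases "as = []")
      case True
      then show ?thesis using shift_int[of 0 a] v0 by simp
    next
      case False
      \<comment> \<open>The bound is used only to keep the tail value away from 0, so that the
        inversion equation applies.\<close>
      then have "cfrac_value as \<ge> 1" using Cons.prems by (intro cfrac_value_ge_1) (auto simp: cfrac_list_def)
      then have "v (1 / cfrac_value as) = 1 / qsubst (- 1) (qcfrac qvar as)"
        using inv'[of "cfrac_value as"] Cons cfrac_list_tl False em1 by simp
      then show ?thesis
        using False shift_int[of "1 / cfrac_value as" a]
        by (simp add: cfrac_value_Cons qcfrac_Cons bar.map_qcfrac bar_qvar add.commute)
    qed
  qed (simp add: cfrac_list_def)
  then show ?thesis using cfrac_expansion_exists[of x] qrat_cfrac_value by metis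
qed

section \<open>Base change of webs\<close>

lemma typed_set_web: "typed S f A B \<Longrightarrow> set_web f \<subseteq> S"
  by (induction rule: typed.induct) auto

lemma map_web_ladder_merge [simp]: "map_web \<phi> (ladder_merge k l) = ladder_merge k l"
  by (simp add: ladder_merge_def)

lemma map_web_ladder_split [simp]: "map_web \<phi> (ladder_split k l) = ladder_split k l"
  by (simp add: ladder_split_def)

lemma map_web_rung_web [simp]: "map_web \<phi> (rung_web r ks) = rung_web r ks"
  by (cases r) (simp_all add: rungE_def rungF_def)

lemma map_web_ladder [simp]: "map_web \<phi> (ladder rs ks) = ladder rs ks"
  by (induction rs) simp_all

lemma map_web_cups [simp]: "map_web \<phi> (cups A) = cups A"
  by (induction A) simp_all

lemma map_web_caps [simp]: "map_web \<phi> (caps A) = caps A"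
  by (induction A) simp_all

lemma map_web_left_transpose [simp]:
  "map_web \<phi> (left_transpose A B f) = left_transpose A B (map_web \<phi> f)"
  by (simp add: left_transpose_def)

lemma map_web_right_transpose [simp]:
  "map_web \<phi> (right_transpose A B f) = right_transpose A B (map_web \<phi> f)"
  by (simp add: right_transpose_def)

lemma map_web_split_merge [simp]: "map_web \<phi> split_merge = split_merge"
  by (simp add: split_merge_def)

lemma map_web_right_trace [simp]: "map_web \<phi> (right_trace f) = right_trace (map_web \<phi> f)"
  by (simp add: right_trace_def)

lemma map_web_left_trace [simp]: "map_web \<phi> (left_trace f) = left_trace (map_web \<phi> f)"
  by (simp add: left_trace_def)

lemma map_web_square_halves [simp]:
  "map_web \<phi> square_bottom = square_bottom" "map_web \<phi> square_top = square_top"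
  by (simp_all add: square_bottom_def square_top_def)

lemma map_web_Sq [simp]: "map_web \<phi> Sq = Sq" "map_web \<phi> Sq_mirror = Sq_mirror"
  by (simp_all add: Sq_def Sq_mirror_def)

text \<open>A map that is additive and multiplicative on a subring need not respect the inverses and
  quotients in the relations. So the image of every coefficient occurring in a relation is
  prescribed separately.\<close>

locale web_base_change =
  fixes S :: "'k::field set" and q a :: 'k and S' :: "'l::field set" and q' a' :: 'l
    and \<phi> :: "'k \<Rightarrow> 'l"
  assumes closed: "c \<in> S \<Longrightarrow> \<phi> c \<in> S'"
    and add: "c \<in> S \<Longrightarrow> d \<in> S \<Longrightarrow> \<phi> (c + d) = \<phi> c + \<phi> d"
    and mult: "c \<in> S \<Longrightarrow> d \<in> S \<Longrightarrow> \<phi> (c * d) = \<phi> c * \<phi> d"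
    and zero [simp]: "\<phi> 0 = 0" and one [simp]: "\<phi> 1 = 1" and neg_one [simp]: "\<phi> (- 1) = - 1"
    and digon_coeff [simp]: "\<phi> (q powi m * qbinom q n k) = q' powi m * qbinom q' n k"
    and commutator_coeff [simp]: "\<phi> (q powi m * qint q m') = q' powi m * qint q' m'"
    and crossing_coeffs [simp]: "\<phi> ((- q) ^ n) = (- q') ^ n" "\<phi> ((- q) powi m) = (- q') powi m"
    and circle_coeff [simp]:
      "\<phi> ((a - inverse a) / (q - inverse q)) = (a' - inverse a') / (q' - inverse q')"
    and trace_coeff [simp]: "\<phi> ((a * inverse q - inverse a * q) / (q - inverse q)) =
      (a' * inverse q' - inverse a' * q') / (q' - inverse q')"
    and square_coeff [simp]: "\<phi> ((a * q powi (-2) - inverse a * q\<^sup>2) / (q - inverse q)) =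
      (a' * q' powi (-2) - inverse a' * q'\<^sup>2) / (q' - inverse q')"
begin

lemma map_web_typed: "typed S f A B \<Longrightarrow> typed S' (map_web \<phi> f) A B"
  by (induction rule: typed.induct) (auto intro: typed.intros closed)

lemma map_web_crossing [simp]: "map_web \<phi> (crossing q k l) = crossing q' k l"
proof -
  have "map_web \<phi> (foldr Plus (map (\<lambda>b. Scale ((- q) powi (b - int k)) (ladder (rs b) ks)) bs) (Zero A B)) =
    foldr Plus (map (\<lambda>b. Scale ((- q') powi (b - int k)) (ladder (rs b) ks)) bs) (Zero A B)"
    for rs ks bs A B
    by (induction bs) (simp_all del: ladder.simps)
  then show ?thesis unfolding crossing_def by (simp del: ladder.simps)
qed

lemma map_web_minus_web [simp]:
  "map_web \<phi> (minus_web f g) = minus_web (map_web \<phi> f) (map_web \<phi> g)"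
  by (simp add: minus_web_def)

lemma map_web_upward_rel:
  "upward_rel q f g \<Longrightarrow> upward_rel q' (map_web \<phi> f) (map_web \<phi> g)"
proof (induction rule: upward_rel.induct)
  case (digon k l)
  then show ?case using upward_rel.digon[of q' k l] by (simp del: mult_minus_left of_nat_mult)
next
  case (EF_commutator k l)
  then show ?case using upward_rel.EF_commutator[of k l q'] by (simp del: ladder.simps One_nat_def)
next
  case (merge_assoc k l m)
  then show ?case using upward_rel.merge_assoc by simp
next
  case (split_coassoc k l m)
  then show ?case using upward_rel.split_coassoc by simp
next
  case (serre P i i' k l m A B)
  then show ?case using upward_rel.serre[OF serre.hyps, of q' A B] by (simp del: ladder.simps)
qed

text \<open>Sums and products of scalars are respected only inside \<open>S\<close>; the hypotheses
  on \<open>set_web\<close> give that membership in \<open>scale_scale\<close> and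
  \<open>scale_plus_scalars\<close>.\<close>

lemma map_web_web_rel:
  assumes "web_rel S q a f g" "set_web f \<subseteq> S" "set_web g \<subseteq> S"
  shows "web_rel S' q' a' (map_web \<phi> f) (map_web \<phi> g)"
  using assms
proof (induction rule: web_rel.induct)
  case (scale_plus_scalars c d f)
  then show ?case by (simp add: add web_rel.scale_plus_scalars)
next
  case (scale_scale c d f)
  then show ?case by (simp add: mult web_rel.scale_scale)
next
  case (pivotal f A B)
  then show ?case by (simp add: map_web_typed web_rel.pivotal)
next
  case (braid_natural f A A' g B B')
  then show ?case by (simp add: map_web_typed web_rel.braid_natural)
next
  case (upward f g)
  then show ?case by (intro web_rel.upward map_web_upward_rel)
next
  case (circle s)
  then show ?case using web_rel.circle[OF circle.hyps] by simp
next
  case right_partial_trace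
  then show ?case using web_rel.right_partial_trace by simp
next
  case left_partial_trace
  then show ?case using web_rel.left_partial_trace by simp
next
  case square
  then show ?case using web_rel.square by simp
next
  case square_mirror
  then show ?case using web_rel.square_mirror by simp
next
  case (braid_upward k l)
  then show ?case by (simp add: web_rel.braid_upward)
\<comment> \<open>Each remaining relation simplifies to an instance of itself.\<close>
qed (simp_all, (rule web_rel.intros)+)

lemma map_web_eq: "web_eq S q a f g \<Longrightarrow> web_eq S' q' a' (map_web \<phi> f) (map_web \<phi> g)"
proof (induction rule: web_eq.induct)
  case (rel f g A B)
  then show ?case using typed_set_web by (blast intro: web_eq.rel map_web_web_rel map_web_typed)
next
  case (refl f A B)
  then show ?case by (blast intro: web_eq.refl map_web_typed)
next
  case (sym f g)
  then show ?case by (blast intro: web_eq.sym)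
next
  case (trans f g h)
  then show ?case by (blast intro: web_eq.trans)
next
  case (comp f g A B f' g')
  then show ?case using map_web_typed[OF comp.hyps(1)] by (simp add: web_eq.comp)
next
  case (tens f g A B f' g')
  then show ?case using map_web_typed[OF tens.hyps(1)] by (simp add: web_eq.tens)
next
  case (plus f g A B f' g')
  then show ?case using map_web_typed[OF plus.hyps(1)] by (simp add: web_eq.plus)
next
  case (scale c f f')
  then show ?case by (simp add: web_eq.scale closed)
qed

end

lemma web_class_eq: "web_eq S q a f g \<Longrightarrow> web_class S q a f = web_class S q a g"
  unfolding web_class_def by (blast intro: web_eq.sym web_eq.trans)

lemma in_web_class: "typed S f A B \<Longrightarrow> f \<in> web_class S q a f"
  unfolding web_class_def by (blast intro: web_eq.refl)

inductive_cases typed_CompE: "typed S (Comp f g) A B"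
inductive_cases typed_TensE: "typed S (Tens f g) A B"
inductive_cases typed_PlusE: "typed S (Plus f g) A B"

text \<open>The congruence rules of \<open>web_eq\<close> make the unions over representatives
  constant; typing keeps them from being empty, since the class of an untyped web is empty.\<close>

lemma web_category_operations:
  assumes "C = web_category S q a"
  shows "typed S (Comp f g) A B \<Longrightarrow>
      compose C (web_class S q a f) (web_class S q a g) = web_class S q a (Comp f g)"
    and "typed S (Tens f g) A B \<Longrightarrow>
      tensor C (web_class S q a f) (web_class S q a g) = web_class S q a (Tens f g)"
    and "typed S (Plus f g) A B \<Longrightarrow>
      plus_hom C (web_class S q a f) (web_class S q a g) = web_class S q a (Plus f g)"
    and "c \<in> S \<Longrightarrow> typed S f A B \<Longrightarrow>
      scale_hom C c (web_class S q a f) = web_class S q a (Scale c f)"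
proof -
  have eq: "(\<Union>f'\<in>web_class S q a f. \<Union>g'\<in>web_class S q a g. web_class S q a (op f' g')) =
      web_class S q a (op f g)"
    if "typed S f A B" "typed S g A' B'"
      and cong: "\<And>f' g'. web_eq S q a f f' \<Longrightarrow> web_eq S q a g g' \<Longrightarrow> web_eq S q a (op f g) (op f' g')"
    for op A B A' B'
  proof -
    have "web_class S q a (op f' g') = web_class S q a (op f g)"
      if "f' \<in> web_class S q a f" "g' \<in> web_class S q a g" for f' g'
    proof -
      have "web_eq S q a (op f g) (op f' g')"
        using that cong by (simp add: web_class_def)
      then show ?thesis by (simp add: web_class_eq)
    qed
    then have "(\<Union>f'\<in>web_class S q a f. \<Union>g'\<in>web_class S q a g. web_class S q a (op f' g')) =
        (\<Union>f'\<in>web_class S q a f. \<Union>g'\<in>web_class S q a g. web_class S q a (op f g))"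
      by (intro SUP_cong HOL.refl)
    also have "\<dots> = web_class S q a (op f g)"
      using in_web_class[OF that(1), of q a] in_web_class[OF that(2), of q a] by auto
    finally show ?thesis .
  qed
  show "compose C (web_class S q a f) (web_class S q a g) = web_class S q a (Comp f g)"
    if "typed S (Comp f g) A B"
  proof -
    from that obtain A B A' B' where "typed S f A B" "typed S g A' B'"
      by (rule typed_CompE) blast
    from eq[where op = Comp, OF this web_eq.comp[OF that]] show ?thesis
      by (simp add: assms web_category_def)
  qed
  show "tensor C (web_class S q a f) (web_class S q a g) = web_class S q a (Tens f g)"
    if "typed S (Tens f g) A B"
  proof -
    from that obtain A B A' B' where "typed S f A B" "typed S g A' B'"
      by (rule typed_TensE) blast
    from eq[where op = Tens, OF this web_eq.tens[OF that]] show ?thesis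
      by (simp add: assms web_category_def)
  qed
  show "plus_hom C (web_class S q a f) (web_class S q a g) = web_class S q a (Plus f g)"
    if "typed S (Plus f g) A B"
  proof -
    from that obtain A B A' B' where "typed S f A B" "typed S g A' B'"
      by (rule typed_PlusE) blast
    from eq[where op = Plus, OF this web_eq.plus[OF that]] show ?thesis
      by (simp add: assms web_category_def)
  qed
  show "scale_hom C c (web_class S q a f) = web_class S q a (Scale c f)"
    if "c \<in> S" "typed S f A B"
  proof -
    have "web_class S q a (Scale c f') = web_class S q a (Scale c f)"
      if "f' \<in> web_class S q a f" for f'
    proof -
      have "web_eq S q a (Scale c f) (Scale c f')"
        using that \<open>c \<in> S\<close> by (simp add: web_class_def web_eq.scale)
      then show ?thesis by (simp add: web_class_eq)
    qed
    then have "(\<Union>f'\<in>web_class S q a f. web_class S q a (Scale c f')) =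
        (\<Union>f'\<in>web_class S q a f. web_class S q a (Scale c f))"
      by (intro SUP_cong HOL.refl)
    also have "\<dots> = web_class S q a (Scale c f)"
      using in_web_class[OF that(2), of q a] by auto
    finally show ?thesis by (simp add: assms web_category_def)
  qed
qed

context web_base_change
begin

definition class_map :: "'k web set \<Rightarrow> 'l web set" where
  "class_map = restrict (\<lambda>U. \<Union>f\<in>U. web_class S' q' a' (map_web \<phi> f))
     (\<Union>A B. homs (web_category S q a) A B)"

lemma class_map_web_class:
  assumes "typed S f A B"
  shows "class_map (web_class S q a f) = web_class S' q' a' (map_web \<phi> f)"
proof -
  have "web_class S' q' a' (map_web \<phi> g) = web_class S' q' a' (map_web \<phi> f)"
    if "g \<in> web_class S q a f" for g
  proof -
    have "web_eq S' q' a' (map_web \<phi> f) (map_web \<phi> g)"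
      using that map_web_eq by (simp add: web_class_def)
    then show ?thesis by (simp add: web_class_eq)
  qed
  then have "(\<Union>g\<in>web_class S q a f. web_class S' q' a' (map_web \<phi> g)) =
      (\<Union>g\<in>web_class S q a f. web_class S' q' a' (map_web \<phi> f))"
    by (intro SUP_cong HOL.refl)
  also have "\<dots> = web_class S' q' a' (map_web \<phi> f)"
    using in_web_class[OF assms, of q a] by auto
  finally show ?thesis
    using assms unfolding class_map_def by (subst restrict_apply') (auto simp: web_category_def)
qed

lemma semilinear_functor_class_map:
  "semilinear_functor (web_category S q a) (web_category S' q' a') (restrict \<phi> S) class_map"
proof -
  let ?C = "web_category S q a" and ?D = "web_category S' q' a'"
  note ops = web_category_operations[OF HOL.refl]
  have homs: "\<exists>f. typed S f A B \<and> U = web_class S q a f" if "U \<in> homs ?C A B" for U A B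
    using that by (auto simp: web_category_def)
  show ?thesis
    unfolding semilinear_functor_def
  proof (intro conjI allI ballI impI)
    fix A B U assume "U \<in> homs ?C A B"
    then obtain f where "typed S f A B" "U = web_class S q a f" using homs by blast
    then show "class_map U \<in> homs ?D A B"
      using class_map_web_class map_web_typed by (auto simp: web_category_def)
  next
    fix A :: obj assume "valid_obj A"
    then have "typed S (Ident A) A A" by (rule typed.intros)
    then show "class_map (ident ?C A) = ident ?D A"
      using class_map_web_class by (simp add: web_category_def)
  next
    fix A B B' U V assume "U \<in> homs ?C B B'" "V \<in> homs ?C A B"
    then obtain f g where fg: "typed S f B B'" "U = web_class S q a f" "typed S g A B"
      "V = web_class S q a g" using homs by metis
    then have t: "typed S (Comp f g) A B'" by (blast intro: typed.intros)
    then show "class_map (compose ?C U V) = compose ?D (class_map U) (class_map V)"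
      using fg map_web_typed[OF t] by (simp add: ops class_map_web_class)
  next
    fix A A' B B' U V assume "U \<in> homs ?C A A'" "V \<in> homs ?C B B'"
    then obtain f g where fg: "typed S f A A'" "U = web_class S q a f" "typed S g B B'"
      "V = web_class S q a g" using homs by metis
    then have t: "typed S (Tens f g) (A @ B) (A' @ B')" by (blast intro: typed.intros)
    then show "class_map (tensor ?C U V) = tensor ?D (class_map U) (class_map V)"
      using fg map_web_typed[OF t] by (simp add: ops class_map_web_class)
  next
    fix A B U V assume "U \<in> homs ?C A B" "V \<in> homs ?C A B"
    then obtain f g where fg: "typed S f A B" "U = web_class S q a f" "typed S g A B"
      "V = web_class S q a g" using homs by metis
    then have t: "typed S (Plus f g) A B" by (blast intro: typed.intros)
    then show "class_map (plus_hom ?C U V) = plus_hom ?D (class_map U) (class_map V)"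
      using fg map_web_typed[OF t] by (simp add: ops class_map_web_class)
  next
    fix A B c U assume c: "c \<in> scalars ?C" and "U \<in> homs ?C A B"
    then obtain f where f: "typed S f A B" "U = web_class S q a f" using homs by metis
    have c: "c \<in> S" using c by (simp add: web_category_def)
    then have t: "typed S (Scale c f) A B" using f by (blast intro: typed.intros)
    then show "class_map (scale_hom ?C c U) = scale_hom ?D (restrict \<phi> S c) (class_map U)"
      using f c closed[OF c] map_web_typed[OF f(1)] by (simp add: ops class_map_web_class)
  qed
qed

end

section \<open>Specialization functors\<close>

interpretation ac: field_map "to_ac :: Qq \<Rightarrow> Qqbar"
  by (rule field_map_to_ac)

lemma field_map_const: "field_map (\<lambda>c::'a::field. to_fract [:c:])"
proof
  fix x y :: 'a
  have "[:x * y:] = [:x:] * [:y:]" by simp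
  then show "to_fract [:x * y:] = to_fract [:x:] * to_fract [:y:]" by (simp only: to_fract_mult)
  have "[:x + y:] = [:x:] + [:y:]" by simp
  then show "to_fract [:x + y:] = to_fract [:x:] + to_fract [:y:]" by (simp only: to_fract_add)
qed (simp flip: one_pCons)

interpretation const: field_map "\<lambda>c::Qq. to_fract [:c:]"
  by (rule field_map_const)

lemma q_ac_nonzero: "q_ac \<noteq> 0"
  by (simp add: q_ac_def qvar_nonzero)

lemma q_ac_power2_neq_1: "q_ac\<^sup>2 \<noteq> 1"
proof
  assume "q_ac\<^sup>2 = 1"
  then have "to_ac (qvar\<^sup>2) = to_ac 1" by (simp add: q_ac_def)
  then show False using qvar_power2_neq_1 by (simp only: to_ac_eq_iff)
qed

lemma q_minus_inverse_nonzero: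
  fixes q :: "'a::field"
  shows "q \<noteq> 0 \<Longrightarrow> q\<^sup>2 \<noteq> 1 \<Longrightarrow> q - inverse q \<noteq> 0"
  by (simp add: field_simps power2_eq_square)

lemma uminus_ring_of_type_algebra: "\<ominus>\<^bsub>ring_of_type_algebra\<^esub> x = - (x :: 'a::comm_ring_1)"
proof -
  interpret cring "ring_of_type_algebra :: 'a ring" by (rule cring_from_type_algebra)
  show ?thesis
    by (rule minus_equality) (simp_all add: ring_of_type_algebra_def)
qed

lemma coeff_ring_closed:
  "1 \<in> coeff_ring"
  "f \<in> coeff_ring \<Longrightarrow> - f \<in> coeff_ring"
  "f \<in> coeff_ring \<Longrightarrow> g \<in> coeff_ring \<Longrightarrow> f + g \<in> coeff_ring"
  "f \<in> coeff_ring \<Longrightarrow> g \<in> coeff_ring \<Longrightarrow> f * g \<in> coeff_ring"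
  "q_inf \<in> coeff_ring" "inverse q_inf \<in> coeff_ring" "a_inf \<in> coeff_ring"
  "inverse (q_inf - inverse q_inf) \<in> coeff_ring"
  unfolding coeff_ring_def
  using generate_ring.one[of "ring_of_type_algebra :: Qqa ring"]
    generate_ring.a_inv[of _ "ring_of_type_algebra :: Qqa ring"]
    generate_ring.eng_add[of _ "ring_of_type_algebra :: Qqa ring"]
    generate_ring.eng_mult[of _ "ring_of_type_algebra :: Qqa ring"]
  by (simp_all add: uminus_ring_of_type_algebra generate_ring.incl)
    (simp_all add: ring_of_type_algebra_def)

lemma coeff_ring_induct [consumes 1, case_names one gen uminus add mult]:
  assumes "f \<in> coeff_ring"
    and "P 1"
    and "\<And>g. g \<in> {q_inf, inverse q_inf, a_inf, inverse a_inf, inverse (q_inf - inverse q_inf)} \<Longrightarrow> P g"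
    and "\<And>g. P g \<Longrightarrow> P (- g)"
    and "\<And>g g'. P g \<Longrightarrow> P g' \<Longrightarrow> P (g + g')"
    and "\<And>g g'. P g \<Longrightarrow> P g' \<Longrightarrow> P (g * g')"
  shows "P f"
  using assms(1) unfolding coeff_ring_def
proof (induction rule: generate_ring.induct)
  case one
  then show ?case using assms(2) by (simp add: ring_of_type_algebra_def)
next
  case (a_inv h)
  then show ?case using assms(4) by (simp add: uminus_ring_of_type_algebra)
next
  case (eng_add h1 h2)
  then show ?case using assms(5) by (simp add: ring_of_type_algebra_def)
next
  case (eng_mult h1 h2)
  then show ?case using assms(6) by (simp add: ring_of_type_algebra_def)
qed (rule assms(3))

lemma adjoin_root_scale:
  assumes "c \<noteq> 0"
  shows "adjoin_root (to_ac c * s) = adjoin_root s"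
proof -
  have "to_ac u + to_ac v * (to_ac c * s) = to_ac u + to_ac (v * c) * s" for u v
    by simp
  moreover have "to_ac u + to_ac v * s = to_ac u + to_ac (v / c) * (to_ac c * s)" for u v
    using assms by simp
  ultimately show ?thesis unfolding adjoin_root_def by blast
qed

text \<open>At \<open>a = q^n\<close> the quadratic extension collapses to the base field, as the
  target \<open>nWeb n\<close> requires.\<close>

lemma adjoin_root_of_base: "adjoin_root (to_ac c) = range to_ac"
proof -
  have "to_ac u + to_ac v * to_ac c = to_ac (u + v * c)" for u v by simp
  moreover have "to_ac u = to_ac u + to_ac 0 * to_ac c" for u by simp
  ultimately show ?thesis unfolding adjoin_root_def by blast
qed

lemma to_ac_in_adjoin_root: "to_ac c \<in> adjoin_root s"
proof -
  have "to_ac c = to_ac c + to_ac 0 * s" by simp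
  then show ?thesis unfolding adjoin_root_def by blast
qed

lemma root_in_adjoin_root: "s \<in> adjoin_root s"
proof -
  have "s = to_ac 0 + to_ac 1 * s" by simp
  then show ?thesis unfolding adjoin_root_def by blast
qed

lemma adjoin_root_add:
  assumes "x \<in> adjoin_root s" "y \<in> adjoin_root s"
  shows "x + y \<in> adjoin_root s"
proof -
  obtain u v u' v' where "x = to_ac u + to_ac v * s" "y = to_ac u' + to_ac v' * s"
    using assms unfolding adjoin_root_def by blast
  then have "x + y = to_ac (u + u') + to_ac (v + v') * s" by (simp add: algebra_simps)
  then show ?thesis unfolding adjoin_root_def by blast
qed

lemma adjoin_root_uminus:
  assumes "x \<in> adjoin_root s"
  shows "- x \<in> adjoin_root s"
proof -
  obtain u v where "x = to_ac u + to_ac v * s" using assms unfolding adjoin_root_def by blast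
  then have "- x = to_ac (- u) + to_ac (- v) * s" by simp
  then show ?thesis unfolding adjoin_root_def by blast
qed

lemma adjoin_root_mult:
  assumes "s\<^sup>2 = to_ac w" "x \<in> adjoin_root s" "y \<in> adjoin_root s"
  shows "x * y \<in> adjoin_root s"
proof -
  obtain u v u' v' where xy: "x = to_ac u + to_ac v * s" "y = to_ac u' + to_ac v' * s"
    using assms(2,3) unfolding adjoin_root_def by blast
  have "x * y = to_ac u * to_ac u' + to_ac v * to_ac v' * s\<^sup>2 + (to_ac u * to_ac v' + to_ac v * to_ac u') * s"
    unfolding xy by (simp add: algebra_simps power2_eq_square)
  then have "x * y = to_ac (u * u' + v * v' * w) + to_ac (u * v' + v * u') * s"
    by (simp add: assms(1))
  then show ?thesis unfolding adjoin_root_def by blast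
qed

text \<open>A total function is needed for \<open>map_web\<close>; it is meaningful only where
  \<open>fract_eval\<close> has a value.\<close>

definition eval_scalar :: "Qqbar \<Rightarrow> Qqa \<Rightarrow> Qqbar" where
  "eval_scalar s f = (THE z. fract_eval to_ac s f z)"

lemma eval_scalar_eq: "fract_eval to_ac s f z \<Longrightarrow> eval_scalar s f = z"
  unfolding eval_scalar_def by (blast intro: the_equality ac.fract_eval_unique)

lemma eval_scalar_const: "eval_scalar s (to_fract [:c:]) = to_ac c"
  by (rule eval_scalar_eq) (rule ac.fract_eval_const)

lemma fract_eval_q_inf: "fract_eval to_ac s q_inf q_ac"
  unfolding q_inf_def q_ac_def by (rule ac.fract_eval_const)

lemma fract_eval_a_inf: "fract_eval to_ac s a_inf s"
  unfolding a_inf_def by (rule ac.fract_eval_var)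

lemmas q_ac_diff_nonzero = q_minus_inverse_nonzero[OF q_ac_nonzero q_ac_power2_neq_1]

lemma coeff_ring_eval:
  assumes "f \<in> coeff_ring" "s \<noteq> 0" "s\<^sup>2 = to_ac w"
  shows "\<exists>z \<in> adjoin_root s. fract_eval to_ac s f z"
  using assms(1)
proof (induction rule: coeff_ring_induct)
  case one
  then show ?case using to_ac_in_adjoin_root[of 1] by (auto intro: ac.fract_eval_1)
next
  case (gen g)
  have "w \<noteq> 0" using assms(2,3) by auto
  \<comment> \<open>From \<open>s * s = to_ac w\<close> the inverse is again a base multiple of
    \<open>s\<close>, so closure under products suffices.\<close>
  then have "inverse s = to_ac (inverse w) * s"
    using assms(2,3) by (simp add: field_simps power2_eq_square)
  then have s: "inverse s \<in> adjoin_root s"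
    using adjoin_root_mult[OF assms(3) to_ac_in_adjoin_root root_in_adjoin_root] by metis
  have q: "q_ac \<in> adjoin_root s" "inverse q_ac \<in> adjoin_root s"
      "inverse (q_ac - inverse q_ac) \<in> adjoin_root s"
    using to_ac_in_adjoin_root[of qvar] to_ac_in_adjoin_root[of "inverse qvar"]
      to_ac_in_adjoin_root[of "inverse (qvar - inverse qvar)"]
    by (simp_all add: q_ac_def)
  have "fract_eval to_ac s (inverse q_inf) (inverse q_ac)"
    by (intro ac.fract_eval_inverse fract_eval_q_inf q_ac_nonzero)
  moreover have "fract_eval to_ac s (inverse a_inf) (inverse s)"
    by (intro ac.fract_eval_inverse fract_eval_a_inf assms(2))
  moreover have "fract_eval to_ac s (inverse (q_inf - inverse q_inf)) (inverse (q_ac - inverse q_ac))"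
    by (intro ac.fract_eval_inverse ac.fract_eval_diff fract_eval_q_inf q_ac_nonzero q_ac_diff_nonzero)
  ultimately show ?case
    using gen s q root_in_adjoin_root[of s] fract_eval_q_inf[of s] fract_eval_a_inf[of s] by blast
next
  case (uminus g)
  then show ?case by (blast intro: adjoin_root_uminus ac.fract_eval_uminus)
next
  case (add g g')
  then show ?case by (blast intro: adjoin_root_add ac.fract_eval_add)
next
  case (mult g g')
  then show ?case by (blast intro: adjoin_root_mult[OF assms(3)] ac.fract_eval_mult)
qed

text \<open>Coefficients in \<open>q\<close> alone are images of constants of \<open>Qq\<close>, so
  two field embeddings carry them across; those involving \<open>a\<close> are evaluated along their
  arithmetic expression.\<close>

lemma web_base_change_eval_scalar:
  assumes "s \<noteq> 0" "s\<^sup>2 = to_ac w"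
  shows "web_base_change coeff_ring q_inf a_inf (adjoin_root s) q_ac s (eval_scalar s)"
proof
  note eval = coeff_ring_eval[OF _ assms]
  note q_eval = fract_eval_q_inf[of s] ac.fract_eval_inverse[OF fract_eval_q_inf q_ac_nonzero, of s]
  note a_eval = fract_eval_a_inf[of s] ac.fract_eval_inverse[OF fract_eval_a_inf assms(1)]
  show "eval_scalar s c \<in> adjoin_root s" if "c \<in> coeff_ring" for c
    using eval[OF that] eval_scalar_eq by metis
  show "eval_scalar s (c + d) = eval_scalar s c + eval_scalar s d"
    if "c \<in> coeff_ring" "d \<in> coeff_ring" for c d
    using eval[OF that(1)] eval[OF that(2)] eval_scalar_eq ac.fract_eval_add by metis
  show "eval_scalar s (c * d) = eval_scalar s c * eval_scalar s d"
    if "c \<in> coeff_ring" "d \<in> coeff_ring" for c d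
    using eval[OF that(1)] eval[OF that(2)] eval_scalar_eq ac.fract_eval_mult by metis
  show "eval_scalar s 0 = 0" "eval_scalar s 1 = 1" "eval_scalar s (- 1) = - 1"
    by (intro eval_scalar_eq ac.fract_eval_uminus ac.fract_eval_0 ac.fract_eval_1)+
  show "eval_scalar s (q_inf powi m * qbinom q_inf n k) = q_ac powi m * qbinom q_ac n k" for m n k
    using eval_scalar_const[of s "qvar powi m * qbinom qvar n k"]
    by (simp only: const.map_mult const.map_power_int const.map_qbinom ac.map_mult ac.map_power_int
        ac.map_qbinom q_inf_def q_ac_def)
  show "eval_scalar s (q_inf powi m * qint q_inf m') = q_ac powi m * qint q_ac m'" for m m'
    using eval_scalar_const[of s "qvar powi m * qint qvar m'"]
    by (simp only: const.map_mult const.map_power_int const.map_qint ac.map_mult ac.map_power_int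
        ac.map_qint q_inf_def q_ac_def)
  show "eval_scalar s ((- q_inf) ^ n) = (- q_ac) ^ n" for n
    using eval_scalar_const[of s "(- qvar) ^ n"]
    by (simp only: const.map_power const.map_uminus ac.map_power ac.map_uminus q_inf_def q_ac_def)
  show "eval_scalar s ((- q_inf) powi m) = (- q_ac) powi m" for m
    using eval_scalar_const[of s "(- qvar) powi m"]
    by (simp only: const.map_power_int const.map_uminus ac.map_power_int ac.map_uminus
        q_inf_def q_ac_def)
  show "eval_scalar s ((a_inf - inverse a_inf) / (q_inf - inverse q_inf)) =
      (s - inverse s) / (q_ac - inverse q_ac)"
    by (intro eval_scalar_eq ac.fract_eval_divide ac.fract_eval_diff q_eval a_eval q_ac_diff_nonzero)
  show "eval_scalar s ((a_inf * inverse q_inf - inverse a_inf * q_inf) / (q_inf - inverse q_inf)) =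
      (s * inverse q_ac - inverse s * q_ac) / (q_ac - inverse q_ac)"
    by (intro eval_scalar_eq ac.fract_eval_divide ac.fract_eval_diff ac.fract_eval_mult
        q_eval a_eval q_ac_diff_nonzero)
  show "eval_scalar s ((a_inf * q_inf powi (-2) - inverse a_inf * q_inf\<^sup>2) / (q_inf - inverse q_inf)) =
      (s * q_ac powi (-2) - inverse s * q_ac\<^sup>2) / (q_ac - inverse q_ac)"
    by (intro eval_scalar_eq ac.fract_eval_divide ac.fract_eval_diff ac.fract_eval_mult
        ac.fract_eval_power ac.fract_eval_power_int q_eval a_eval q_ac_diff_nonzero q_ac_nonzero)
qed

lemma specialization_exists:
  assumes "s \<noteq> 0" "s\<^sup>2 = to_ac w"
  shows "\<exists>T. is_specialization T (web_category (adjoin_root s) q_ac s) s"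
proof -
  interpret web_base_change coeff_ring q_inf a_inf "adjoin_root s" q_ac s "eval_scalar s"
    using assms by (rule web_base_change_eval_scalar)
  have a: "restrict (eval_scalar s) coeff_ring a_inf = s"
    by (simp add: coeff_ring_closed eval_scalar_eq[OF fract_eval_a_inf])
  define T where "T = \<lparr>target = web_category (adjoin_root s) q_ac s,
    on_scalars = restrict (eval_scalar s) coeff_ring, on_morphisms = class_map\<rparr>"
  have "specialization_functor T"
    unfolding specialization_functor_def T_def spec_functor.simps a
  proof (intro conjI allI impI)
    show "restrict (eval_scalar s) coeff_ring \<in>
        ring_hom (ring_of_type_algebra\<lparr>carrier := coeff_ring\<rparr>)
          (ring_of_type_algebra\<lparr>carrier := adjoin_root s\<rparr>)"
      by (rule ring_hom_memI)
        (simp_all add: ring_of_type_algebra_def closed add mult coeff_ring_closed)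
    show "restrict (eval_scalar s) coeff_ring q_inf = q_ac"
      by (simp add: coeff_ring_closed eval_scalar_eq[OF fract_eval_q_inf])
    show "s\<^sup>2 \<in> range to_ac" by (simp add: assms(2))
    show "semilinear_functor infWeb (web_category (adjoin_root s) q_ac s)
        (restrict (eval_scalar s) coeff_ring) class_map"
      unfolding infWeb_def by (rule semilinear_functor_class_map)
    show "class_map \<in> extensional (\<Union>A B. homs infWeb A B)"
      by (simp add: class_map_def infWeb_def)
    fix f A B assume f: "typed coeff_ring f A B"
    have "map_web (restrict (eval_scalar s) coeff_ring) f = map_web (eval_scalar s) f"
      using typed_set_web[OF f] by (intro web.map_cong0) auto
    then show "class_map (web_class coeff_ring q_inf a_inf f) =
        web_class (scalars (web_category (adjoin_root s) q_ac s))
          (qpar (web_category (adjoin_root s) q_ac s)) (apar (web_category (adjoin_root s) q_ac s))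
          (map_web (restrict (eval_scalar s) coeff_ring) f)"
      using class_map_web_class[OF f] by (simp add: web_category_def)
  qed simp_all
  moreover have "target T = web_category (adjoin_root s) q_ac s" "on_scalars T a_inf = s"
    using a by (simp_all add: T_def)
  ultimately show ?thesis unfolding is_specialization_def by blast
qed

section \<open>The stabilized unknot\<close>

text \<open>An arbitrary specialization is only known to be a ring homomorphism on
  \<open>coeff_ring\<close>. So the quotient is first shown to lie there, and then its denominator
  is cleared.\<close>

lemma on_scalars_stab_unknot:
  assumes "specialization_functor T"
  shows "on_scalars T stab_unknot = ((on_scalars T a_inf)\<^sup>2 - 1) / (q_ac\<^sup>2 - 1)"
proof -
  let ?h = "on_scalars T"
  have hom: "?h \<in> ring_hom (ring_of_type_algebra\<lparr>carrier := coeff_ring\<rparr>)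
       (ring_of_type_algebra\<lparr>carrier := adjoin_root (?h a_inf)\<rparr>)" and q: "?h q_inf = q_ac"
    using assms by (simp_all add: specialization_functor_def)
  note h = ring_hom_mult[OF hom] ring_hom_add[OF hom] ring_hom_one[OF hom]
  have mult: "?h (f * g) = ?h f * ?h g" and add: "?h (f + g) = ?h f + ?h g"
    if "f \<in> coeff_ring" "g \<in> coeff_ring" for f g
    using that h by (simp_all add: ring_of_type_algebra_def)
  have one: "?h 1 = 1" using h by (simp add: ring_of_type_algebra_def)
  have q_inf: "q_inf \<noteq> 0" "q_inf\<^sup>2 - 1 \<noteq> 0"
  proof -
    have "q_inf\<^sup>2 - 1 = to_fract [:qvar\<^sup>2 - 1:]"
      by (simp only: const.map_diff const.map_power const.map_1 q_inf_def)
    then show "q_inf\<^sup>2 - 1 \<noteq> 0" using qvar_ne(2) by (simp only: const.map_eq_0) simp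
    show "q_inf \<noteq> 0" using qvar_nonzero by (simp add: q_inf_def)
  qed
  \<comment> \<open>As \<open>q * (q - q^(-1)) = q^2 - 1\<close>, the inverse of the denominator is
    a product of two generators.\<close>
  then have "inverse q_inf * inverse (q_inf - inverse q_inf) = inverse (q_inf\<^sup>2 - 1)"
    by (simp add: right_diff_distrib power2_eq_square flip: inverse_mult_distrib)
  then have "stab_unknot = (a_inf * a_inf + - 1) * (inverse q_inf * inverse (q_inf - inverse q_inf))"
    by (simp add: stab_unknot_def divide_inverse power2_eq_square)
  moreover have "(a_inf * a_inf + - 1) * (inverse q_inf * inverse (q_inf - inverse q_inf)) \<in> coeff_ring"
    by (intro coeff_ring_closed)
  ultimately have stab: "stab_unknot \<in> coeff_ring" by simp
  have "stab_unknot * (q_inf\<^sup>2 - 1) = a_inf\<^sup>2 - 1"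
    using q_inf by (simp add: stab_unknot_def)
  \<comment> \<open>Arranged without subtraction, so that additivity and multiplicativity apply
    directly.\<close>
  then have "stab_unknot * (q_inf * q_inf) + 1 = a_inf * a_inf + stab_unknot"
    by (simp add: algebra_simps power2_eq_square)
  then have "?h (stab_unknot * (q_inf * q_inf) + 1) = ?h (a_inf * a_inf + stab_unknot)" by simp
  then have "?h stab_unknot * (q_ac * q_ac) + 1 = ?h a_inf * ?h a_inf + ?h stab_unknot"
    by (simp add: add mult one q stab coeff_ring_closed)
  then have "?h stab_unknot * (q_ac\<^sup>2 - 1) = (?h a_inf)\<^sup>2 - 1"
    by (simp add: algebra_simps power2_eq_square)
  then show ?thesis using q_ac_power2_neq_1 by (simp add: eq_divide_eq)
qed

lemma stab_value_root_class:
  assumes "specialization_functor T" "(on_scalars T a_inf)\<^sup>2 = to_ac w"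
  shows "stab_value (root_class T) = (w - 1) / (qvar\<^sup>2 - 1)"
proof -
  have val: "on_scalars T' stab_unknot = to_ac ((w - 1) / (qvar\<^sup>2 - 1))" if "T' \<in> root_class T" for T'
  proof -
    have T': "specialization_functor T'"
      "on_scalars T' a_inf = on_scalars T a_inf \<or> on_scalars T' a_inf = - on_scalars T a_inf"
      using that by (auto simp: root_class_def)
    then have "(on_scalars T' a_inf)\<^sup>2 = to_ac w" using assms(2) by auto
    then show ?thesis using on_scalars_stab_unknot[OF T'(1)] by (simp add: q_ac_def)
  qed
  \<comment> \<open>A member of the class is needed for uniqueness in the definite description
    \<open>stab_value\<close>.\<close>
  have "T \<in> root_class T" using assms(1) by (simp add: root_class_def)
  show ?thesis
    unfolding stab_value_def
  proof (rule the_equality)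
    show "\<forall>T' \<in> root_class T. on_scalars T' stab_unknot = to_ac ((w - 1) / (qvar\<^sup>2 - 1))"
      using val by blast
    fix v assume "\<forall>T' \<in> root_class T. on_scalars T' stab_unknot = to_ac v"
    then have "to_ac v = to_ac ((w - 1) / (qvar\<^sup>2 - 1))"
      using val[OF \<open>T \<in> root_class T\<close>] \<open>T \<in> root_class T\<close> by metis
    then show "v = (w - 1) / (qvar\<^sup>2 - 1)" by (simp only: to_ac_eq_iff)
  qed
qed

text \<open>Equal squares mean equal or opposite roots, which is exactly what the class forgets.
  Thus uniqueness of the family reduces to computing the image of \<open>a^2\<close>.\<close>

lemma root_class_eq:
  "(on_scalars T a_inf)\<^sup>2 = (on_scalars T' a_inf)\<^sup>2 \<Longrightarrow> root_class T = root_class T'"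
  unfolding root_class_def power2_eq_iff by auto

lemma canonical_family_root:
  assumes \<F>: "canonical_family \<F>" and T: "specialization_functor T" "\<F> x = root_class T"
  shows "(on_scalars T a_inf)\<^sup>2 = to_ac (qvar\<^sup>2 * qdelta x)"
proof -
  define v where "v x = stab_value (\<F> x)" for x
  from \<F> obtain \<alpha> e where e: "e \<in> {1, - 1 :: int}"
    and inv: "\<And>x. x \<noteq> 0 \<Longrightarrow> v (1 / x) = qvar powi \<alpha> * (1 / qsubst e (v x))"
    unfolding canonical_family_def v_def by blast
  have "v (of_nat n) = qint qvar (int n)" for n
  proof -
    obtain T' where T': "is_specialization T' (nWeb n) (q_ac ^ n)" "\<F> (of_nat n) = root_class T'"
      using \<F> unfolding canonical_family_def by blast
    then have "specialization_functor T'" "on_scalars T' a_inf = q_ac ^ n"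
      by (simp_all add: is_specialization_def)
    moreover have "(q_ac ^ n)\<^sup>2 = to_ac (qvar powi (2 * int n))"
    proof -
      have "qvar powi (2 * int n) = (qvar ^ n)\<^sup>2"
        using power_int_of_nat[of qvar "2 * n"] by (simp add: power_mult[symmetric] mult.commute)
      then show ?thesis by (simp add: q_ac_def)
    qed
    ultimately show ?thesis
      using stab_value_root_class[of T' "qvar powi (2 * int n)"] T'(2) by (simp add: v_def qint_def)
  qed
  moreover have "v (x + 1) = qvar\<^sup>2 * v x + 1" for x
    using \<F> unfolding canonical_family_def v_def by blast
  ultimately have v: "v x = qrat x" using e inv by (rule qrat_unique)
  obtain w where w: "(on_scalars T a_inf)\<^sup>2 = to_ac w"
    using T(1) unfolding specialization_functor_def by blast
  have "qrat x = (w - 1) / (qvar\<^sup>2 - 1)"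
    using v stab_value_root_class[OF T(1) w] T(2) by (simp add: v_def)
  then have "(qvar\<^sup>2 - 1) * qrat x = w - 1" using qvar_ne(2) by simp
  then show ?thesis using w qdelta_qrat[of x] by simp
qed

section \<open>Square roots and existence of the family\<close>

lemma root_choice_exists: "\<exists>\<nu>. root_choice \<nu>"
proof -
  have root: "\<exists>r. r\<^sup>2 = to_ac (inverse (qdelta x))" for x
    by (rule nth_root_exists) simp
  define \<nu> where "\<nu> x = (if x \<in> \<int> then q_ac powi (1 - \<lfloor>x\<rfloor>)
    else SOME r. r\<^sup>2 = to_ac (inverse (qdelta x)))" for x
  have int: "\<nu> (of_int n) = q_ac powi (1 - n)" for n
    by (simp add: \<nu>_def)
  have "(\<nu> x)\<^sup>2 = to_ac (inverse (qdelta x))" for x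
  proof (cases "x \<in> \<int>")
    case True
    then obtain n where x: "x = of_int n" by (auto elim: Ints_cases)
    \<comment> \<open>The value prescribed at an integer \<open>n\<close> is an admissible root
      because \<open>qdelta n = q^(2n - 2)\<close>.\<close>
    have "(q_ac powi (1 - n))\<^sup>2 = q_ac powi (- (2 * n - 2))"
      by (simp add: power_int_power' algebra_simps)
    also have "\<dots> = to_ac (inverse (qdelta x))"
      unfolding x qdelta_of_int power_int_minus q_ac_def ac.map_inverse ac.map_power_int ..
    finally show ?thesis using int x by simp
  next
    case False
    then show ?thesis using someI_ex[OF root[of x]] by (simp add: \<nu>_def)
  qed
  then show ?thesis using int unfolding root_choice_def by blast
qed

lemma a_value_power2:
  assumes "root_choice \<nu>"
  shows "(a_value \<nu> x)\<^sup>2 = to_ac (qvar\<^sup>2 * qdelta x)"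
proof -
  have "(\<nu> x)\<^sup>2 = inverse (to_ac (qdelta x))" using assms by (simp add: root_choice_def)
  moreover have "to_ac (qdelta x) \<noteq> 0" by (simp add: qdelta_nonzero)
  ultimately show ?thesis
    by (simp add: a_value_def q_ac_def power_mult_distrib) (simp add: power2_eq_square)
qed

text \<open>The normalization of \<open>\<nu>\<close> at integers enters here:
  \<open>q * q^(1 - n) * q^(2n - 2) = q^n\<close> holds exactly, whereas the square alone leaves the
  sign open.\<close>

lemma a_value_of_nat:
  assumes "root_choice \<nu>"
  shows "a_value \<nu> (of_nat n) = q_ac ^ n"
proof -
  have "\<nu> (of_int (int n)) = q_ac powi (1 - int n)" using assms by (simp only: root_choice_def)
  moreover have "to_ac (qdelta (of_int (int n))) = q_ac powi (2 * int n - 2)"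
    unfolding qdelta_of_int q_ac_def ac.map_power_int ..
  ultimately have "a_value \<nu> (of_nat n) = q_ac powi 1 * q_ac powi (1 - int n) * q_ac powi (2 * int n - 2)"
    by (simp add: a_value_def)
  also have "\<dots> = q_ac powi (int n)"
    using q_ac_nonzero by (simp only: power_int_add[symmetric] simp_thms) simp
  finally show ?thesis by simp
qed

text \<open>\<open>a_value\<close> is a nonzero base multiple of \<open>\<nu> x\<close>, so both
  generate the coefficient ring that \<open>xWeb\<close> prescribes.\<close>

lemma xWeb_specialization_exists:
  assumes "root_choice \<nu>"
  shows "\<exists>T. is_specialization T (xWeb \<nu> x) (a_value \<nu> x)"
proof -
  have "a_value \<nu> x = to_ac (qvar * qdelta x) * \<nu> x" by (simp add: a_value_def q_ac_def)
  then have "adjoin_root (a_value \<nu> x) = adjoin_root (\<nu> x)"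
    using adjoin_root_scale[of "qvar * qdelta x" "\<nu> x"] qvar_nonzero qdelta_nonzero
    by (simp del: to_ac_mult)
  moreover have "a_value \<nu> x \<noteq> 0"
    using a_value_power2[OF assms, of x] qvar_nonzero qdelta_nonzero[of x] by auto
  ultimately show ?thesis
    using specialization_exists[OF _ a_value_power2[OF assms]] by (metis xWeb_def)
qed

lemma canonical_familyI:
  assumes \<nu>: "root_choice \<nu>"
    and T: "\<And>x. is_specialization (T x) (xWeb \<nu> x) (a_value \<nu> x)"
  shows "canonical_family (\<lambda>x. root_class (T x))"
proof -
  have spec: "specialization_functor (T x)" and a: "on_scalars (T x) a_inf = a_value \<nu> x" for x
    using T[of x] by (simp_all add: is_specialization_def)
  have stab: "stab_value (root_class (T x)) = qrat x" for x
  proof -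
    have "stab_value (root_class (T x)) = (qvar\<^sup>2 * qdelta x - 1) / (qvar\<^sup>2 - 1)"
      using spec by (rule stab_value_root_class) (simp only: a a_value_power2[OF \<nu>])
    then show ?thesis using qvar_ne(2) by (simp add: qdelta_qrat)
  qed
  have "is_specialization (T (of_nat n)) (nWeb n) (q_ac ^ n)" for n
  proof -
    have "target (T (of_nat n)) = web_category (adjoin_root (q_ac ^ n)) q_ac (q_ac ^ n)"
      using spec[of "of_nat n"] unfolding specialization_functor_def a a_value_of_nat[OF \<nu>] by blast
    moreover have "adjoin_root (q_ac ^ n) = range to_ac"
      using adjoin_root_of_base[of "qvar ^ n"] by (simp add: q_ac_def)
    ultimately show ?thesis
      using spec a a_value_of_nat[OF \<nu>] by (simp add: is_specialization_def nWeb_def)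
  qed
  moreover have "\<exists>\<alpha>::int. \<exists>\<epsilon>\<in>{1, -1}. \<forall>x. x \<noteq> 0 \<longrightarrow>
      qrat x \<noteq> 0 \<and> qrat (1 / x) = qvar powi \<alpha> * (1 / qsubst \<epsilon> (qrat x))"
    by (rule exI[of _ 0], rule bexI[of _ "- 1"]) (simp_all add: qrat_nonzero qrat_inverse)
  ultimately show ?thesis
    unfolding canonical_family_def stab using spec qrat_add1 by blast
qed

theorem theorem5p2:
  "(\<exists>!\<F>. canonical_family \<F>) \<and>
   (\<exists>\<nu>. root_choice \<nu>) \<and>
   (\<forall>\<nu> \<F>. root_choice \<nu> \<longrightarrow> canonical_family \<F> \<longrightarrow>
      (\<forall>x. \<exists>T. is_specialization T (xWeb \<nu> x) (a_value \<nu> x) \<and> \<F> x = root_class T))"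
proof (intro conjI allI impI)
  \<comment> \<open>Any canonical family agrees with any specialization at \<open>a_value\<close>,
    for every choice of roots. This yields uniqueness and the explicit description at once.\<close>
  have root: "\<F> x = root_class T"
    if \<F>: "canonical_family \<F>" and "root_choice \<nu>" "is_specialization T (xWeb \<nu> x) (a_value \<nu> x)"
    for \<F> \<nu> x T
  proof -
    obtain T' where T': "specialization_functor T'" "\<F> x = root_class T'"
      using \<F> unfolding canonical_family_def by blast
    have "(on_scalars T' a_inf)\<^sup>2 = (on_scalars T a_inf)\<^sup>2"
      using canonical_family_root[OF \<F> T'] a_value_power2[OF that(2)] that(3)
      by (simp add: is_specialization_def)
    then show ?thesis unfolding T'(2) by (rule root_class_eq)
  qed
  show "\<exists>\<nu>. root_choice \<nu>" by (rule root_choice_exists)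
  then obtain \<nu> where \<nu>: "root_choice \<nu>" ..
  define T where "T x = (SOME T. is_specialization T (xWeb \<nu> x) (a_value \<nu> x))" for x
  have T: "is_specialization (T x) (xWeb \<nu> x) (a_value \<nu> x)" for x
    unfolding T_def using xWeb_specialization_exists[OF \<nu>] by (rule someI_ex)
  show "\<exists>!\<F>. canonical_family \<F>"
  proof (rule ex1I)
    show "canonical_family (\<lambda>x. root_class (T x))" using \<nu> T by (rule canonical_familyI)
    show "\<F> = (\<lambda>x. root_class (T x))" if "canonical_family \<F>" for \<F>
      by (rule ext) (rule root[OF that \<nu> T])
  qed
  show "\<exists>T. is_specialization T (xWeb \<nu> x) (a_value \<nu> x) \<and> \<F> x = root_class T"
    if "root_choice \<nu>" "canonical_family \<F>" for \<nu> \<F> x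
  proof -
    obtain T where "is_specialization T (xWeb \<nu> x) (a_value \<nu> x)"
      using xWeb_specialization_exists[OF \<open>root_choice \<nu>\<close>] by blast
    with root[OF that(2,1) this] show ?thesis by blast
  qed
qed

end
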